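(* Let $K$ be a field and let ${\bf n}=(n_1,n_2,n_3,n_4)$ be a sequence of positive integers with $\gcd(n_1,n_2,n_3,n_4)=1$. For each $i$ let $a_i$ be the least positive integer such that $a_i n_i\in\sum_{j\neq i}\mathbb{N}n_j$. Suppose that $I({\bf n})$ is minimally generated by the three binomials $$x_1^{a_1}-x_2^{a_2},\qquad x_3^{a_3}-x_4^{a_4},\qquad x_1^{u_1}x_2^{u_2}-x_3^{u_3}x_4^{u_4},$$ where $u_1,u_2,u_3,u_4\in\mathbb{N}$, and that $n_1=\min\{n_1,n_2,n_3,n_4\}$, $a_3<a_4$, $u_2\le a_2$ and $u_3\le a_3$. Suppose that either $u_3=0$ or $u_4=0$. Then $C({\bf n})$ has Cohen-Macaulay tangent cone at the origin if and only if the ideal $I({\bf n})_*$ is a complete intersection.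
   Context: $\mathbb{N}$ is the set of non-negative integers. For a sequence ${\bf n}=(n_1,\ldots,n_4)$ of positive integers with gcd $1$, $I({\bf n})$ is the toric ideal, i.e. the kernel of the $K$-algebra homomorphism $K[x_1,\ldots,x_4]\to K[t]$, $x_i\mapsto t^{n_i}$; it has height $3$ and is the defining ideal of the monomial curve $C({\bf n})$ parametrized by $x_i=t^{n_i}$. For a nonzero polynomial $f$, $f_*$ denotes the homogeneous summand of $f$ of least degree, and $I({\bf n})_*$ is the ideal generated by all $f_*$ with $f\in I({\bf n})$, $f\neq 0$; it is the defining ideal of the tangent cone of $C({\bf n})$ at $0$. $C({\bf n})$ has Cohen-Macaulay tangent cone at the origin if the ring $K[x_1,\ldots,x_4]/I({\bf n})_*$ is Cohen-Macaulay. The ideal $I({\bf n})_*$ (of height $3$) is a complete intersection if its minimal number of generators is $3$. *)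

theory Defs
  imports
    "HOL-Algebra.Algebraic_Closure_Type"
    "HOL-Computational_Algebra.Polynomial"
    "HOL-Library.Poly_Mapping"
    "HOL-Library.Numeral_Type"
    "HOL-Library.Extended_Nat"
begin

section \<open>Commutative algebra over an arbitrary ring record\<close>

definition minimally_generated_by :: "('a, 'b) ring_scheme \<Rightarrow> 'a set \<Rightarrow> 'a list \<Rightarrow> bool" where
  "minimally_generated_by R I fs \<longleftrightarrow>
     set fs \<subseteq> carrier R \<and> Idl\<^bsub>R\<^esub> (set fs) = I \<and>
     (\<forall>i < length fs. Idl\<^bsub>R\<^esub> (set (take i fs @ drop (Suc i) fs)) \<noteq> I)"

text \<open>The infimum is \<open>\<infinity>\<close> for an ideal that is not finitely generated.\<close>

definition min_num_generators :: "('a, 'b) ring_scheme \<Rightarrow> 'a set \<Rightarrow> enat" where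
  "min_num_generators R I =
     (INF S \<in> {S. S \<subseteq> carrier R \<and> finite S \<and> Idl\<^bsub>R\<^esub> S = I}. enat (card S))"

definition regular_sequence :: "('a, 'b) ring_scheme \<Rightarrow> 'a list \<Rightarrow> bool" where
  "regular_sequence R xs \<longleftrightarrow>
     set xs \<subseteq> carrier R \<and>
     (\<forall>i < length xs. \<forall>y \<in> carrier R.
        xs ! i \<otimes>\<^bsub>R\<^esub> y \<in> Idl\<^bsub>R\<^esub> (set (take i xs)) \<longrightarrow> y \<in> Idl\<^bsub>R\<^esub> (set (take i xs))) \<and>
     Idl\<^bsub>R\<^esub> (set xs) \<noteq> carrier R"

definition ideal_depth :: "('a, 'b) ring_scheme \<Rightarrow> 'a set \<Rightarrow> enat" where
  "ideal_depth R I =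
     (SUP xs \<in> {xs. regular_sequence R xs \<and> set xs \<subseteq> I}. enat (length xs))"

definition prime_height :: "('a, 'b) ring_scheme \<Rightarrow> 'a set \<Rightarrow> enat" where
  "prime_height R P =
     (SUP h \<in> {h. \<exists>Q :: nat \<Rightarrow> 'a set.
          (\<forall>i \<le> h. primeideal (Q i) R) \<and> (\<forall>i < h. Q i \<subset> Q (Suc i)) \<and> Q h = P}. enat h)"

text \<open>
  This is the definition in Eisenbud, \<open>Commutative Algebra with a View Toward Algebraic
  Geometry\<close>, Section 18.2: depth and codimension agree at every maximal ideal. The depth of a
  maximal ideal \<open>M\<close> of a Noetherian ring is the depth of the local ring at \<open>M\<close>, and the height
  of \<open>M\<close> is its dimension, so no localization is needed.
\<close>

definition cohen_macaulay_ring :: "('a, 'b) ring_scheme \<Rightarrow> bool" where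
  "cohen_macaulay_ring R \<longleftrightarrow>
     cring R \<and> noetherian_ring R \<and>
     (\<forall>M. maximalideal M R \<longrightarrow> ideal_depth R M = prime_height R M)"


section \<open>Polynomials\<close>

text \<open>
  Polynomials in variables indexed by \<open>'v\<close> are finitely supported maps from exponent vectors to
  coefficients.
\<close>

type_synonym ('v, 'k) mpoly = "('v \<Rightarrow>\<^sub>0 nat) \<Rightarrow>\<^sub>0 'k"

abbreviation mpoly_ring :: "('v, 'k::field) mpoly ring" where
  "mpoly_ring \<equiv> ring_of_type_algebra"

definition var :: "'v \<Rightarrow> ('v, 'k::field) mpoly" where
  "var i = Poly_Mapping.single (Poly_Mapping.single i 1) 1"

definition total_degree :: "('v::finite \<Rightarrow>\<^sub>0 nat) \<Rightarrow> nat" where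
  "total_degree m = (\<Sum>i\<in>UNIV. Poly_Mapping.lookup m i)"

definition homogeneous_component :: "nat \<Rightarrow> ('v::finite, 'k::field) mpoly \<Rightarrow> ('v, 'k) mpoly" where
  "homogeneous_component d f =
     (\<Sum>m \<in> {m \<in> Poly_Mapping.keys f. total_degree m = d}.
        Poly_Mapping.single m (Poly_Mapping.lookup f m))"

text \<open>The homogeneous summand of least degree; only meaningful for \<open>f \<noteq> 0\<close>.\<close>

definition initial_form :: "('v::finite, 'k::field) mpoly \<Rightarrow> ('v, 'k) mpoly" where
  "initial_form f = homogeneous_component (Min (total_degree ` Poly_Mapping.keys f)) f"


section \<open>Monomial curves\<close>

text \<open>The \<open>K\<close>-algebra homomorphism with \<open>x\<^sub>i \<mapsto> t ^ n i\<close>.\<close>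

definition toric_hom :: "('v::finite \<Rightarrow> nat) \<Rightarrow> ('v, 'k::field) mpoly \<Rightarrow> 'k poly" where
  "toric_hom n f =
     (\<Sum>m \<in> Poly_Mapping.keys f.
        Polynomial.smult (Poly_Mapping.lookup f m)
          (\<Prod>i\<in>UNIV. (Polynomial.monom 1 (n i)) ^ Poly_Mapping.lookup m i))"

definition toric_ideal :: "('v::finite \<Rightarrow> nat) \<Rightarrow> ('v, 'k::field) mpoly set" where
  "toric_ideal n = {f. toric_hom n f = 0}"

definition tangent_cone_ideal :: "('v::finite \<Rightarrow> nat) \<Rightarrow> ('v, 'k::field) mpoly set" where
  "tangent_cone_ideal n = Idl\<^bsub>mpoly_ring\<^esub> {initial_form f | f. f \<in> toric_ideal n \<and> f \<noteq> 0}"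

definition cohen_macaulay_tangent_cone :: "'k::field itself \<Rightarrow> ('v::finite \<Rightarrow> nat) \<Rightarrow> bool" where
  "cohen_macaulay_tangent_cone K n \<longleftrightarrow>
     cohen_macaulay_ring (mpoly_ring Quot (tangent_cone_ideal n :: ('v, 'k) mpoly set))"

text \<open>
  For four positive exponents the ideal of the tangent cone has height 3, so being a complete
  intersection means being generated by 3, and no fewer, elements.
\<close>

definition complete_intersection_tangent_cone :: "'k::field itself \<Rightarrow> (4 \<Rightarrow> nat) \<Rightarrow> bool" where
  "complete_intersection_tangent_cone K n \<longleftrightarrow>
     min_num_generators mpoly_ring (tangent_cone_ideal n :: (4, 'k) mpoly set) = 3"

text \<open>The least positive \<open>a\<close> such that \<open>a * n i\<close> lies in the semigroup generated by the others.\<close>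

definition critical_exponent :: "('v::finite \<Rightarrow> nat) \<Rightarrow> 'v \<Rightarrow> nat" where
  "critical_exponent n i =
     (LEAST a. 0 < a \<and> (\<exists>c :: 'v \<Rightarrow> nat. a * n i = (\<Sum>j \<in> UNIV - {i}. c j * n j)))"

text \<open>
  The variables are indexed by the four-element type \<open>4\<close>, whose elements are \<open>1, 2, 3, 4\<close>
  (where \<open>4 = 0\<close>).
\<close>

end

theory Submission
  imports Defs
begin

text \<open>
  After exchanging the third generator for \<open>x\<^sub>1\<^bsup>u\<^sub>1\<^esup> x\<^sub>2\<^bsup>u\<^sub>2\<^esup> - x\<^sub>4\<^bsup>u\<^sub>4\<^esup>\<close> with \<open>0 < u\<^sub>1\<close>,
  \<open>u\<^sub>2 < a\<^sub>2\<close> and \<open>0 < u\<^sub>4\<close>, the three binomials form a Groebner basis with leading monomials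
  \<open>x\<^sub>2\<^bsup>a\<^sub>2\<^esup>\<close>, \<open>x\<^sub>3\<^bsup>a\<^sub>3\<^esup>\<close>, \<open>x\<^sub>4\<^bsup>u\<^sub>4\<^esup>\<close>. If \<open>u\<^sub>4 \<le> u\<^sub>1 + u\<^sub>2\<close>, reduction never lowers the degree, so the initial
  forms of the generators generate the ideal of the tangent cone and the quotient is free over
  \<open>K[x\<^sub>1]\<close>: both sides of the equivalence hold. If \<open>u\<^sub>1 + u\<^sub>2 < u\<^sub>4\<close>, then \<open>x\<^sub>1\<^bsup>u\<^sub>1\<^esup> x\<^sub>2\<^bsup>u\<^sub>2\<^esup>\<close> lies in this ideal
  while \<open>x\<^sub>2\<^bsup>u\<^sub>2\<^esup>\<close> does not; as the reduced tangent cone is a line, the depth at the origin is 0.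
  Moreover \<open>x\<^sub>2\<^bsup>a\<^sub>2\<^esup>\<close>, \<open>x\<^sub>3\<^bsup>a\<^sub>3\<^esup>\<close>, \<open>x\<^sub>1\<^bsup>u\<^sub>1\<^esup> x\<^sub>2\<^bsup>u\<^sub>2\<^esup>\<close> are part of a minimal system of generators, and a fourth
  one is needed because of \<open>x\<^sub>1\<^bsup>u\<^sub>1 + a\<^sub>1\<^esup> - x\<^sub>2\<^bsup>a\<^sub>2 - u\<^sub>2\<^esup> x\<^sub>4\<^bsup>u\<^sub>4\<^esup>\<close>. So both sides fail.

  Depth and height at an arbitrary maximal ideal are computed through the restriction of
  polynomials to the reduced tangent cone, whose kernel is nil modulo the ideal of the cone.
\<close>

section \<open>Ideals of commutative rings and their quotients\<close>

abbreviation tring :: "'a::comm_ring_1 ring" where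
  "tring \<equiv> ring_of_type_algebra"

lemma tring_simps [simp]:
  "carrier (tring :: 'a::comm_ring_1 ring) = UNIV"
  "x \<otimes>\<^bsub>tring\<^esub> y = x * (y :: 'a)"
  "x \<oplus>\<^bsub>tring\<^esub> y = x + (y :: 'a)"
  "\<zero>\<^bsub>tring\<^esub> = (0 :: 'a)"
  "\<one>\<^bsub>tring\<^esub> = (1 :: 'a)"
  by (simp_all add: ring_of_type_algebra_def)

lemma ring_tring: "ring (tring :: 'a::comm_ring_1 ring)"
  and cring_tring: "cring (tring :: 'a::comm_ring_1 ring)"
  by (rule ring_from_type_algebra, rule cring_from_type_algebra)

lemma ideal_tringI:
  fixes I :: "'a::comm_ring_1 set"
  assumes "0 \<in> I" and add: "\<And>x y. x \<in> I \<Longrightarrow> y \<in> I \<Longrightarrow> x + y \<in> I"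
    and mult: "\<And>r x. x \<in> I \<Longrightarrow> r * x \<in> I"
  shows "ideal I tring"
proof (rule idealI[OF ring_tring])
  interpret ring "tring :: 'a ring"
    by (rule ring_tring)
  have "\<ominus>\<^bsub>tring\<^esub> x = - x" for x :: 'a
    by (rule minus_equality) auto
  then have "inv\<^bsub>add_monoid tring\<^esub> x \<in> I" if "x \<in> I" for x
    using mult[OF that, of "-1"] unfolding a_inv_def[symmetric] by simp
  then show "subgroup I (add_monoid (tring :: 'a ring))"
    using assms(1) add by (intro subgroup.intro) auto
qed (use mult in \<open>auto simp: mult.commute\<close>)

lemma ideal_tringD:
  fixes I :: "'a::comm_ring_1 set"
  assumes "ideal I tring"
  shows "0 \<in> I" and "x \<in> I \<Longrightarrow> y \<in> I \<Longrightarrow> x + y \<in> I" and "x \<in> I \<Longrightarrow> r * x \<in> I"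
    and "x \<in> I \<Longrightarrow> x * r \<in> I"
    and "x \<in> I \<Longrightarrow> - x \<in> I" and "x \<in> I \<Longrightarrow> y \<in> I \<Longrightarrow> x - y \<in> I"
proof -
  interpret ideal I tring by fact
  show 0: "0 \<in> I" using additive_subgroup.zero_closed[OF is_additive_subgroup] by simp
  show add: "x \<in> I \<Longrightarrow> y \<in> I \<Longrightarrow> x + y \<in> I" for x y
    using additive_subgroup.a_closed[OF is_additive_subgroup] by simp
  show mult: "x \<in> I \<Longrightarrow> r * x \<in> I" for x r
    using I_l_closed[of x r] by simp
  show "x \<in> I \<Longrightarrow> x * r \<in> I"
    using mult[of x r] by (simp add: mult.commute)
  show minus: "x \<in> I \<Longrightarrow> - x \<in> I" for x
    using mult[of x "-1"] by simp
  show "x \<in> I \<Longrightarrow> y \<in> I \<Longrightarrow> x - y \<in> I"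
    using add[of x "- y"] minus[of y] by simp
qed

lemma ideal_tring_sum:
  fixes I :: "'a::comm_ring_1 set"
  assumes "ideal I tring" and "\<And>i. i \<in> A \<Longrightarrow> f i \<in> I"
  shows "sum f A \<in> I"
  using assms(2) by (induction A rule: infinite_finite_induct) (auto intro: ideal_tringD[OF assms(1)])

lemma Idl_tring:
  fixes S :: "'a::comm_ring_1 set"
  shows "ideal (Idl\<^bsub>tring\<^esub> S) tring" and "S \<subseteq> Idl\<^bsub>tring\<^esub> S"
    and "ideal I tring \<Longrightarrow> S \<subseteq> I \<Longrightarrow> Idl\<^bsub>tring\<^esub> S \<subseteq> I"
  using ring.genideal_ideal[OF ring_tring, of S] ring.genideal_self[OF ring_tring, of S]
    ring.genideal_minimal[OF ring_tring, of I S] by auto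

lemma ideal_tring_eq_UNIV: "ideal I (tring :: 'a::comm_ring_1 ring) \<Longrightarrow> 1 \<in> I \<Longrightarrow> I = UNIV"
  using ideal_tringD(3)[of I 1] by auto

lemma ideal_radical:
  fixes J :: "'a::comm_ring_1 set"
  assumes J: "ideal J tring"
  shows "ideal {p. \<exists>k. p ^ k \<in> J} tring"
proof (rule ideal_tringI)
  show "0 \<in> {p. \<exists>k. p ^ k \<in> J}"
    using ideal_tringD(1)[OF J] by (auto intro: exI[of _ 1])
next
  fix x y :: 'a
  assume "x \<in> {p. \<exists>k. p ^ k \<in> J}" "y \<in> {p. \<exists>k. p ^ k \<in> J}"
  then obtain k l where kl: "x ^ k \<in> J" "y ^ l \<in> J"
    by auto
  \<comment> \<open>With exponent \<open>k + l\<close>, each term of the binomial expansion contains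
    \<open>x ^ k\<close> or \<open>y ^ l\<close>: if \<open>i < k\<close>, then
    \<open>k + l - i = (k - i) + l\<close>.\<close>
  have "of_nat ((k + l) choose i) * x ^ i * y ^ (k + l - i) \<in> J" for i
  proof (cases "k \<le> i")
    case True
    then have "x ^ i = x ^ (i - k) * x ^ k"
      by (simp flip: power_add)
    then show ?thesis
      using kl(1) by (simp add: ideal_tringD[OF J])
  next
    case False
    then have "y ^ (k + l - i) = y ^ (k - i) * y ^ l"
      by (simp flip: power_add)
    then show ?thesis
      using kl(2) by (simp add: ideal_tringD[OF J])
  qed
  then have "(x + y) ^ (k + l) \<in> J"
    unfolding binomial_ring by (intro ideal_tring_sum[OF J]) auto
  then show "x + y \<in> {p. \<exists>k. p ^ k \<in> J}"
    by auto
next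
  fix r x :: 'a
  assume "x \<in> {p. \<exists>k. p ^ k \<in> J}"
  then show "r * x \<in> {p. \<exists>k. p ^ k \<in> J}"
    using ideal_tringD(3)[OF J] by (auto simp: power_mult_distrib)
qed

lemma ideal_colon:
  fixes J :: "'a::comm_ring_1 set"
  assumes "ideal J tring"
  shows "ideal {p. c * p \<in> J} tring"
  by (rule ideal_tringI)
     (auto simp: distrib_left mult.left_commute ideal_tringD[OF assms])

lemma primeideal_tringD:
  fixes P :: "'a::comm_ring_1 set"
  assumes "primeideal P tring"
  shows "ideal P tring" and "1 \<notin> P" and "x * y \<in> P \<Longrightarrow> x \<in> P \<or> y \<in> P"
    and "x ^ k \<in> P \<Longrightarrow> x \<in> P"
proof -
  interpret primeideal P tring by fact
  show "ideal P tring" by (rule is_ideal)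
  show 1: "1 \<notin> P"
    using I_notcarr one_imp_carrier by auto
  show prime: "x * y \<in> P \<Longrightarrow> x \<in> P \<or> y \<in> P" for x y
    using I_prime[of x y] by simp
  show "x ^ k \<in> P \<Longrightarrow> x \<in> P"
    using 1 by (induction k) (auto dest: prime)
qed

lemma primeideal_tringI:
  fixes P :: "'a::comm_ring_1 set"
  assumes "ideal P tring" "1 \<notin> P" "\<And>x y. x * y \<in> P \<Longrightarrow> x \<in> P \<or> y \<in> P"
  shows "primeideal P tring"
  using assms by (intro primeidealI cring_tring) auto

section \<open>Residue classes and the correspondence of ideals\<close>

context
  fixes J :: "'a::comm_ring_1 set"
  assumes J: "ideal J tring"
begin

text \<open>Working with representatives turns questions about the quotient record into membership
  questions in \<open>'a\<close>; see \<open>proj_eq_iff\<close> and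
  \<open>carrier_quot\<close>.\<close>

definition proj :: "'a \<Rightarrow> 'a set" where
  "proj p = J +>\<^bsub>tring\<^esub> p"

lemma proj_eq_image: "proj p = (\<lambda>j. j + p) ` J"
  by (auto simp: proj_def a_r_coset_def r_coset_def)

lemma proj_eq_iff: "proj p = proj q \<longleftrightarrow> p - q \<in> J"
proof
  assume "proj p = proj q"
  moreover have "p \<in> proj p"
    using ideal_tringD(1)[OF J] by (force simp: proj_eq_image)
  ultimately show "p - q \<in> J"
    by (auto simp: proj_eq_image)
next
  assume pq: "p - q \<in> J"
  have "j + p \<in> (\<lambda>j. j + q) ` J" if "j \<in> J" for j
    by (rule image_eqI[of _ _ "j + (p - q)"]) (use pq that ideal_tringD[OF J] in auto)
  moreover have "j + q \<in> (\<lambda>j. j + p) ` J" if "j \<in> J" for j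
    by (rule image_eqI[of _ _ "j - (p - q)"]) (use pq that ideal_tringD[OF J] in auto)
  ultimately show "proj p = proj q"
    by (auto simp: proj_eq_image)
qed

lemma carrier_quot: "carrier (tring Quot J) = range proj"
  by (auto simp: FactRing_def A_RCOSETS_def' proj_def)

lemma quot_simps [simp]:
  "proj p \<otimes>\<^bsub>tring Quot J\<^esub> proj q = proj (p * q)"
  "proj p \<oplus>\<^bsub>tring Quot J\<^esub> proj q = proj (p + q)"
  "\<one>\<^bsub>tring Quot J\<^esub> = proj 1"
  "proj p \<in> carrier (tring Quot J)"
  using ideal.rcoset_mult_add[OF J, of p q] ideal.a_rcos_sum[OF J, of p q]
  by (simp_all add: carrier_quot) (simp_all add: FactRing_def proj_def)

lemma zero_quot: "\<zero>\<^bsub>tring Quot J\<^esub> = proj 0"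
  by (simp add: proj_eq_image FactRing_def)

lemma cring_quot: "cring (tring Quot J)"
  by (rule ideal.quotient_is_cring[OF J cring_tring])

lemma ring_quot: "ring (tring Quot J)"
  by (rule ideal.quotient_is_ring[OF J])

lemma ideal_proj_vimage:
  assumes M: "ideal M (tring Quot J)"
  shows "ideal (proj -` M) tring" and "J \<subseteq> proj -` M" and "M = proj ` (proj -` M)"
proof -
  interpret ideal M "tring Quot J" by fact
  have 0: "proj 0 \<in> M"
    using additive_subgroup.zero_closed[OF is_additive_subgroup] by (simp add: zero_quot)
  have add: "proj (p + q) \<in> M" if "proj p \<in> M" "proj q \<in> M" for p q
    using additive_subgroup.a_closed[OF is_additive_subgroup that] by simp
  have mult: "proj (r * p) \<in> M" if "proj p \<in> M" for r p
    using I_l_closed[OF that, of "proj r"] by simp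
  show "ideal (proj -` M) tring"
    by (rule ideal_tringI) (auto intro: 0 add mult)
  have "proj p = proj 0" if "p \<in> J" for p
    using that by (simp add: proj_eq_iff)
  then show "J \<subseteq> proj -` M"
    using 0 by auto
  show "M = proj ` (proj -` M)"
    using a_subset by (auto simp: carrier_quot)
qed

text \<open>Since \<open>J\<close> lies in \<open>P\<close>, membership in \<open>P\<close> does not
  depend on the representative.\<close>

lemma proj_in_image_iff:
  assumes P: "ideal P tring" and "J \<subseteq> P"
  shows "proj p \<in> proj ` P \<longleftrightarrow> p \<in> P"
proof
  assume "proj p \<in> proj ` P"
  then obtain q where q: "q \<in> P" "p - q \<in> J"
    by (auto simp: proj_eq_iff)
  then show "p \<in> P"
    using assms ideal_tringD(2)[OF P, of "p - q" q] by auto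
qed auto

lemma ideal_proj_image: "ideal P tring \<Longrightarrow> ideal (proj ` P) (tring Quot J)"
  using ring.ring_ideal_imp_quot_ideal[OF ring_tring J, of P]
  by (simp add: proj_def[abs_def] image_def)

lemma primeideal_proj_vimage:
  assumes M: "primeideal M (tring Quot J)"
  shows "primeideal (proj -` M) tring"
proof -
  interpret primeideal M "tring Quot J" by fact
  note M' = ideal_proj_vimage[OF is_ideal]
  have "1 \<notin> proj -` M"
    using I_notcarr one_imp_carrier by auto
  then show ?thesis
    using I_prime[of "proj x" "proj y" for x y] by (intro primeideal_tringI M'(1)) auto
qed

lemma primeideal_proj_image:
  assumes P: "primeideal P tring" and JP: "J \<subseteq> P"
  shows "primeideal (proj ` P) (tring Quot J)"
proof (rule primeidealI)
  note P' = primeideal_tringD[OF P]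
  note iff = proj_in_image_iff[OF P'(1) JP]
  show "ideal (proj ` P) (tring Quot J)"
    by (rule ideal_proj_image) fact
  show "cring (tring Quot J)"
    by (rule cring_quot)
  show "carrier (tring Quot J) \<noteq> proj ` P"
    using P'(2) iff[of 1] by (auto simp: carrier_quot)
  show "a \<in> proj ` P \<or> b \<in> proj ` P"
    if ab: "a \<in> carrier (tring Quot J)" "b \<in> carrier (tring Quot J)"
      "a \<otimes>\<^bsub>tring Quot J\<^esub> b \<in> proj ` P" for a b
  proof -
    obtain x y where xy: "a = proj x" "b = proj y"
      using ab(1,2) by (auto simp: carrier_quot)
    then have "x * y \<in> P"
      using ab(3) iff[of "x * y"] by simp
    then show ?thesis
      using P'(3)[of x y] xy by auto
  qed
qed

lemma maximalideal_proj_vimage: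
  assumes M: "maximalideal M (tring Quot J)"
  shows "maximalideal (proj -` M) tring"
proof (rule maximalidealI)
  interpret maximalideal M "tring Quot J" by fact
  note M' = ideal_proj_vimage[OF is_ideal]
  show "ideal (proj -` M) tring" by fact
  show "carrier tring \<noteq> proj -` M"
    using I_notcarr one_imp_carrier by auto
  fix P :: "'a set" assume P: "ideal P tring" "proj -` M \<subseteq> P"
  then have JP: "J \<subseteq> P"
    using M'(2) by auto
  have "M \<subseteq> proj ` P"
    by (subst M'(3)) (use P(2) in blast)
  then have "proj ` P = M \<or> proj ` P = carrier (tring Quot J)"
    by (intro I_maximal ideal_proj_image P) (auto simp: carrier_quot)
  moreover have "proj -` (proj ` P) = P"
    using proj_in_image_iff[OF P(1) JP] by blast
  moreover have "proj -` carrier (tring Quot J) = UNIV"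
    by auto
  ultimately show "P = proj -` M \<or> P = carrier tring"
    by (metis tring_simps(1))
qed

lemma maximalideal_proj_image:
  assumes P: "maximalideal P tring" and JP: "J \<subseteq> P"
  shows "maximalideal (proj ` P) (tring Quot J)"
proof (rule maximalidealI)
  interpret maximalideal P tring by fact
  note iff = proj_in_image_iff[OF is_ideal JP]
  show "ideal (proj ` P) (tring Quot J)"
    by (rule ideal_proj_image) (rule is_ideal)
  show "carrier (tring Quot J) \<noteq> proj ` P"
  proof
    assume "carrier (tring Quot J) = proj ` P"
    then have "p \<in> P" for p
      using iff[of p] by (auto simp: carrier_quot)
    then show False
      using I_notcarr by auto
  qed
  fix M assume M: "ideal M (tring Quot J)" "proj ` P \<subseteq> M"
  then have "proj -` M = P \<or> proj -` M = carrier tring"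
    by (intro I_maximal ideal_proj_vimage) auto
  then show "M = proj ` P \<or> M = carrier (tring Quot J)"
    using ideal_proj_vimage(3)[OF M(1)] by (auto simp: carrier_quot)
qed

lemma Idl_quot_empty: "Idl\<^bsub>tring Quot J\<^esub> {} = {proj 0}"
proof -
  have "Idl\<^bsub>tring Quot J\<^esub> {} \<subseteq> {proj 0}"
    using ring.genideal_minimal[OF ring_quot, of "{proj 0}" "{}"] ring.zeroideal[OF ring_quot]
    by (simp add: zero_quot)
  moreover have "proj 0 \<in> Idl\<^bsub>tring Quot J\<^esub> {}"
    using ideal_proj_vimage[OF ring.genideal_ideal[OF ring_quot, of "{}"]] ideal_tringD(1)
    by auto
  ultimately show ?thesis by auto
qed

text \<open>Translates the condition on the second entry of a regular sequence into a statement on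
  polynomials.\<close>

lemma Idl_quot_singleton:
  "proj z \<in> Idl\<^bsub>tring Quot J\<^esub> {proj p} \<longleftrightarrow> (\<exists>q. z - q * p \<in> J)"
  unfolding cring.cgenideal_eq_genideal[OF cring_quot, of "proj p", simplified, symmetric] cgenideal_def
proof
  assume "proj z \<in> {x \<otimes>\<^bsub>tring Quot J\<^esub> proj p |x. x \<in> carrier (tring Quot J)}"
  then show "\<exists>q. z - q * p \<in> J"
    by (auto simp: carrier_quot proj_eq_iff)
next
  assume "\<exists>q. z - q * p \<in> J"
  then obtain q where "proj z = proj q \<otimes>\<^bsub>tring Quot J\<^esub> proj p"
    by (auto simp: proj_eq_iff)
  then show "proj z \<in> {x \<otimes>\<^bsub>tring Quot J\<^esub> proj p |x. x \<in> carrier (tring Quot J)}"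
    using quot_simps(4) by blast
qed

text \<open>The images of finitely many generators of the preimage generate the given ideal.\<close>

lemma noetherian_quot:
  assumes "noetherian_ring (tring :: 'a ring)"
  shows "noetherian_ring (tring Quot J)"
proof (rule ring.noetherian_ringI[OF ring_quot])
  fix M assume M: "ideal M (tring Quot J)"
  note M' = ideal_proj_vimage[OF M]
  obtain A where A: "finite A" "proj -` M = Idl\<^bsub>tring\<^esub> A"
    using noetherian_ring.finetely_gen[OF assms M'(1)] by auto
  have sub: "proj ` A \<subseteq> carrier (tring Quot J)"
    by auto
  note G = ideal_proj_vimage[OF ring.genideal_ideal[OF ring_quot sub]]
  have AM: "A \<subseteq> proj -` M"
    unfolding A(2) by (rule Idl_tring)
  have "M = Idl\<^bsub>tring Quot J\<^esub> (proj ` A)"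
  proof
    have "A \<subseteq> proj -` (Idl\<^bsub>tring Quot J\<^esub> (proj ` A))"
      using ring.genideal_self[OF ring_quot sub] by auto
    then have "proj -` M \<subseteq> proj -` (Idl\<^bsub>tring Quot J\<^esub> (proj ` A))"
      unfolding A(2) by (intro Idl_tring G)
    then show "M \<subseteq> Idl\<^bsub>tring Quot J\<^esub> (proj ` A)"
      by (subst M'(3)) blast
    show "Idl\<^bsub>tring Quot J\<^esub> (proj ` A) \<subseteq> M"
      by (rule ring.genideal_minimal[OF ring_quot M]) (use AM in auto)
  qed
  then show "\<exists>A\<subseteq>carrier (tring Quot J). finite A \<and> M = Idl\<^bsub>tring Quot J\<^esub> A"
    using A(1) sub by blast
qed

end

section \<open>Polynomials and linear maps on them\<close>

abbreviation coeff_at :: "('v, 'k::field) mpoly \<Rightarrow> ('v \<Rightarrow>\<^sub>0 nat) \<Rightarrow> 'k" where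
  "coeff_at \<equiv> Poly_Mapping.lookup"

abbreviation mon :: "('v \<Rightarrow>\<^sub>0 nat) \<Rightarrow> ('v, 'k::field) mpoly" where
  "mon m \<equiv> Poly_Mapping.single m 1"

lemma mon_eq_iff [simp]: "(mon m :: ('v, 'k::field) mpoly) = mon m' \<longleftrightarrow> m = m'"
proof
  assume "(mon m :: ('v, 'k) mpoly) = mon m'"
  then have "coeff_at (mon m :: ('v, 'k) mpoly) m = coeff_at (mon m') m"
    by simp
  then show "m = m'"
    by (auto simp: lookup_single when_def split: if_splits)
qed auto

lemma mpoly_eq_sum_single:
  "f = (\<Sum>m\<in>Poly_Mapping.keys f. Poly_Mapping.single m (coeff_at f m))"
  by (rule poly_mapping_eqI) (auto simp: lookup_sum lookup_single when_def in_keys_iff)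

text \<open>Additive identities need checking on terms only; zero is the term
  \<open>single 0 0\<close>.\<close>

lemma mpoly_induct [case_names single add]:
  fixes f :: "('v, 'k::field) mpoly"
  assumes single: "\<And>m c. P (Poly_Mapping.single m c)"
    and add: "\<And>f g. P f \<Longrightarrow> P g \<Longrightarrow> P (f + g)"
  shows "P f"
proof -
  have "P 0"
    using single[of 0 0] by simp
  then have "P (\<Sum>m\<in>A. Poly_Mapping.single m (coeff_at f m))" for A
    by (induction A rule: infinite_finite_induct) (auto intro: single add)
  then show ?thesis
    by (subst mpoly_eq_sum_single)
qed

lemma keys_single_mult:
  fixes f :: "('v, 'k::field) mpoly"
  assumes "k \<in> Poly_Mapping.keys (Poly_Mapping.single d c * f)"
  shows "\<exists>m \<in> Poly_Mapping.keys f. k = d + m"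
  using keys_mult[of "Poly_Mapping.single d c" f] assms by (auto split: if_splits)

lemma lookup_single_mult:
  fixes f :: "('v, 'k::field) mpoly"
  shows "coeff_at (Poly_Mapping.single d c * f) (d + m) = c * coeff_at f m"
  by (induction f rule: mpoly_induct)
     (auto simp: distrib_left lookup_add mult_single lookup_single when_def)

lemma lookup_const_mult:
  fixes f :: "('v, 'k::field) mpoly"
  shows "coeff_at (Poly_Mapping.single 0 c * f) m = c * coeff_at f m"
  using lookup_single_mult[of 0 c f m] by simp

text \<open>Values in \<open>K[t]\<close> serve two purposes: powers of \<open>t\<close> give the
  toric homomorphism, and the values \<open>t\<close> and 0 give the restriction to the reduced
  tangent cone.\<close>

definition mpoly_eval :: "('v::finite \<Rightarrow> 'k poly) \<Rightarrow> ('v, 'k::field) mpoly \<Rightarrow> 'k poly" where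
  "mpoly_eval v f =
     (\<Sum>m \<in> Poly_Mapping.keys f. Polynomial.smult (coeff_at f m) (\<Prod>i\<in>UNIV. v i ^ Poly_Mapping.lookup m i))"

lemma toric_hom_eq_eval: "toric_hom n = mpoly_eval (\<lambda>i. Polynomial.monom 1 (n i))"
  by (auto simp: toric_hom_def mpoly_eval_def)

lemma mpoly_eval_add: "mpoly_eval v (f + g) = mpoly_eval v f + mpoly_eval v g"
  unfolding mpoly_eval_def by (rule setsum_keys_plus_distrib) (auto simp: smult_add_left)

lemma mpoly_eval_single:
  "mpoly_eval v (Poly_Mapping.single m c) =
     Polynomial.smult c (\<Prod>i\<in>UNIV. v i ^ Poly_Mapping.lookup m i)"
  by (simp add: mpoly_eval_def)

lemma mpoly_eval_0 [simp]: "mpoly_eval v 0 = 0"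
  by (simp add: mpoly_eval_def)

lemma mpoly_eval_1 [simp]: "mpoly_eval v 1 = 1"
  by (simp add: mpoly_eval_single flip: single_one)

lemma mpoly_eval_mult: "mpoly_eval v (f * g) = mpoly_eval v f * mpoly_eval v g"
proof (induction f rule: mpoly_induct)
  case (single m c)
  show ?case
  proof (induction g rule: mpoly_induct)
    case (single m' c')
    then show ?case
      by (simp add: mult_single mpoly_eval_single lookup_add power_add prod.distrib mult_ac)
  qed (simp add: mpoly_eval_add distrib_left)
qed (simp add: mpoly_eval_add distrib_right)

lemma mpoly_eval_power: "mpoly_eval v (f ^ k) = mpoly_eval v f ^ k"
  by (induction k) (auto simp: mpoly_eval_mult)

lemma mpoly_eval_minus: "mpoly_eval v (- f) = - mpoly_eval v f"
  using mpoly_eval_add[of v f "- f"] by (simp add: add_eq_0_iff)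

lemma mpoly_eval_diff: "mpoly_eval v (f - g) = mpoly_eval v f - mpoly_eval v g"
  using mpoly_eval_add[of v f "- g"] by (simp add: mpoly_eval_minus)

lemma mpoly_eval_sum: "mpoly_eval v (\<Sum>i\<in>A. f i) = (\<Sum>i\<in>A. mpoly_eval v (f i))"
  by (induction A rule: infinite_finite_induct) (auto simp: mpoly_eval_add)

lemma ideal_eval_kernel: "ideal {f. mpoly_eval v f = 0} mpoly_ring"
  by (rule ideal_tringI) (auto simp: mpoly_eval_add mpoly_eval_mult)

text \<open>The \<open>K\<close>-linear map with prescribed values on monomials, constants being
  embedded as \<open>single 0 c\<close>. It models reduction to normal form, which is linear but not
  multiplicative.\<close>

definition linear_ext :: "(('v \<Rightarrow>\<^sub>0 nat) \<Rightarrow> ('v, 'k) mpoly) \<Rightarrow> ('v, 'k::field) mpoly \<Rightarrow> ('v, 'k) mpoly" where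
  "linear_ext \<phi> f = (\<Sum>m \<in> Poly_Mapping.keys f. Poly_Mapping.single 0 (coeff_at f m) * \<phi> m)"

lemma linear_ext_add: "linear_ext \<phi> (f + g) = linear_ext \<phi> f + linear_ext \<phi> g"
  unfolding linear_ext_def by (rule setsum_keys_plus_distrib) (auto simp: single_add distrib_right)

lemma linear_ext_0 [simp]: "linear_ext \<phi> 0 = 0"
  by (simp add: linear_ext_def)

lemma linear_ext_single: "linear_ext \<phi> (Poly_Mapping.single m c) = Poly_Mapping.single 0 c * \<phi> m"
  by (simp add: linear_ext_def)

lemma linear_ext_mon [simp]: "linear_ext \<phi> (mon m) = \<phi> m"
  by (simp add: linear_ext_single)

lemma linear_ext_minus: "linear_ext \<phi> (- f) = - linear_ext \<phi> f"
  using linear_ext_add[of \<phi> f "- f"] by (simp add: add_eq_0_iff)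

lemma linear_ext_diff: "linear_ext \<phi> (f - g) = linear_ext \<phi> f - linear_ext \<phi> g"
  using linear_ext_add[of \<phi> f "- g"] by (simp add: linear_ext_minus)

lemma linear_ext_const_mult:
  "linear_ext \<phi> (Poly_Mapping.single 0 c * f) = Poly_Mapping.single 0 c * linear_ext \<phi> f"
  by (induction f rule: mpoly_induct)
     (auto simp: mult_single linear_ext_single linear_ext_add distrib_left simp flip: mult.assoc)

lemma linear_ext_single_mult:
  assumes "\<And>d m. \<phi> (d + m) = linear_ext \<phi> (mon d * \<phi> m)"
  shows "linear_ext \<phi> (Poly_Mapping.single d c * f) =
         Poly_Mapping.single 0 c * linear_ext \<phi> (mon d * linear_ext \<phi> f)"
proof (induction f rule: mpoly_induct)
  case (single m e)
  have "linear_ext \<phi> (Poly_Mapping.single d c * Poly_Mapping.single m e) =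
        Poly_Mapping.single 0 c * (Poly_Mapping.single 0 e * linear_ext \<phi> (mon d * \<phi> m))"
    by (simp add: mult_single linear_ext_single assms flip: mult.assoc)
  also have "\<dots> = Poly_Mapping.single 0 c * linear_ext \<phi> (mon d * (Poly_Mapping.single 0 e * \<phi> m))"
    by (simp add: linear_ext_const_mult mult.left_commute[of "mon d"])
  finally show ?case
    by (simp add: linear_ext_single)
qed (simp add: linear_ext_add distrib_left)

text \<open>The hypothesis says that in a product one factor may be reduced first. Hence the
  reduction of \<open>r * x\<close> depends on \<open>x\<close> only through its reduction and
  vanishes with it.\<close>

lemma ideal_linear_ext_kernel:
  fixes \<phi> :: "('v \<Rightarrow>\<^sub>0 nat) \<Rightarrow> ('v, 'k::field) mpoly"
  assumes "\<And>d m. \<phi> (d + m) = linear_ext \<phi> (mon d * \<phi> m)"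
  shows "ideal {f. linear_ext \<phi> f = 0} tring"
proof (rule ideal_tringI)
  fix r x :: "('v, 'k) mpoly"
  assume x: "x \<in> {f. linear_ext \<phi> f = 0}"
  have "linear_ext \<phi> (r * x) = 0"
    using x by (induction r rule: mpoly_induct)
      (auto simp: linear_ext_single_mult[OF assms] linear_ext_add distrib_right)
  then show "r * x \<in> {f. linear_ext \<phi> f = 0}"
    by auto
qed (auto simp: linear_ext_add)

text \<open>If single monomials change only by elements of \<open>I\<close>, so do polynomials; in
  particular the kernel of the reduction lies in \<open>I\<close>.\<close>

lemma diff_linear_ext_mem:
  fixes \<phi> :: "('v \<Rightarrow>\<^sub>0 nat) \<Rightarrow> ('v, 'k::field) mpoly"
  assumes I: "ideal I tring" and "\<And>m. mon m - \<phi> m \<in> I"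
  shows "f - linear_ext \<phi> f \<in> I"
proof (induction f rule: mpoly_induct)
  case (single m c)
  have "Poly_Mapping.single m c - linear_ext \<phi> (Poly_Mapping.single m c) =
      Poly_Mapping.single 0 c * (mon m - \<phi> m)"
    by (simp add: linear_ext_single right_diff_distrib mult_single)
  then show ?case
    using assms by (auto intro: ideal_tringD)
next
  case (add f g)
  then show ?case
    using ideal_tringD(2)[OF I add] by (simp add: linear_ext_add algebra_simps)
qed

section \<open>Degrees and initial forms\<close>

lemma total_degree_add: "total_degree (a + b) = total_degree a + total_degree b"
  by (simp add: total_degree_def lookup_add sum.distrib)

lemma lookup_homogeneous_component:
  "coeff_at (homogeneous_component d f) m = (if total_degree m = d then coeff_at f m else 0)"
  by (auto simp: homogeneous_component_def lookup_sum lookup_single when_def in_keys_iff)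

lemma lookup_initial_form:
  "coeff_at (initial_form f) m =
     (if total_degree m = Min (total_degree ` Poly_Mapping.keys f) then coeff_at f m else 0)"
  by (simp add: initial_form_def lookup_homogeneous_component)

lemma keys_initial_formD:
  assumes "m \<in> Poly_Mapping.keys (initial_form f)"
  shows "m \<in> Poly_Mapping.keys f" and "\<And>m'. m' \<in> Poly_Mapping.keys f \<Longrightarrow> total_degree m \<le> total_degree m'"
  using assms by (auto simp: in_keys_iff[of _ "initial_form f"] lookup_initial_form in_keys_iff split: if_splits)

lemma initial_form_eqI:
  assumes "m \<in> Poly_Mapping.keys f" "total_degree m = d"
    and "\<And>m'. m' \<in> Poly_Mapping.keys f \<Longrightarrow> d \<le> total_degree m'"
    and "\<And>m'. coeff_at g m' = (if total_degree m' = d then coeff_at f m' else 0)"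
  shows "initial_form f = g"
proof -
  have "Min (total_degree ` Poly_Mapping.keys f) = d"
    using assms by (intro Min_eqI) auto
  then show ?thesis
    using assms(4) by (intro poly_mapping_eqI) (simp add: lookup_initial_form)
qed

section \<open>Dickson's lemma and the Hilbert basis theorem\<close>

lemma incseq_subseq_nat:
  fixes x :: "nat \<Rightarrow> nat"
  shows "\<exists>s. strict_mono s \<and> incseq (x \<circ> s)"
proof -
  obtain s where s: "strict_mono s" "monoseq (x \<circ> s)"
    using seq_monosub[of x] by (auto simp: o_def)
  show ?thesis
  proof (cases "incseq (x \<circ> s)")
    case False
    then have dec: "decseq (x \<circ> s)"
      using s(2) by (simp add: monoseq_iff)
    \<comment> \<open>A decreasing sequence of naturals is constant from the place where it attains
      its minimum, so its tail is also increasing.\<close>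
    define N where "N = (ARG_MIN (x \<circ> s) i. True)"
    have "(x \<circ> s) N \<le> (x \<circ> s) i" for i
      unfolding N_def by (rule arg_min_nat_le) simp
    then have "(x \<circ> s) (N + i) = (x \<circ> s) N" for i
      using decseqD[OF dec, of N "N + i"] by (intro antisym) auto
    then have "incseq (x \<circ> (\<lambda>i. s (N + i)))"
      by (simp add: incseq_def)
    moreover have "strict_mono (\<lambda>i. s (N + i))"
      using s(1) by (simp add: strict_mono_def)
    ultimately show ?thesis by blast
  qed (use s in auto)
qed

text \<open>Subsequences are extracted for one variable after another, until all exponents increase
  along the same subsequence; its first two members are then comparable.\<close>

lemma Dickson:
  fixes f :: "nat \<Rightarrow> ('v::finite \<Rightarrow>\<^sub>0 nat)"
  shows "\<exists>i j d. i < j \<and> f j = f i + d"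
proof -
  have "\<exists>r. strict_mono r \<and> (\<forall>v\<in>V. incseq (\<lambda>i. Poly_Mapping.lookup (f (r i)) v))" for V
  proof (induction V rule: infinite_finite_induct)
    case (insert v V)
    then obtain r where r: "strict_mono r" "\<And>v. v \<in> V \<Longrightarrow> incseq (\<lambda>i. Poly_Mapping.lookup (f (r i)) v)"
      by auto
    obtain s where s: "strict_mono s" "incseq ((\<lambda>i. Poly_Mapping.lookup (f (r i)) v) \<circ> s)"
      using incseq_subseq_nat by blast
    have "strict_mono (r \<circ> s)"
      using r(1) s(1) by (simp add: strict_mono_def)
    moreover have "incseq (\<lambda>i. Poly_Mapping.lookup (f ((r \<circ> s) i)) w)" if "w \<in> insert v V" for w
    proof (cases "w = v")
      case False
      then show ?thesis
        using that r(2)[of w] s(1) by (auto simp: incseq_def strict_mono_less_eq)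
    qed (use s in \<open>simp add: o_def\<close>)
    ultimately show ?case by blast
  qed (auto intro: exI[of _ id] simp: strict_mono_def)
  from this[of UNIV] obtain r where r: "strict_mono r" "\<And>v. incseq (\<lambda>i. Poly_Mapping.lookup (f (r i)) v)"
    by auto
  have "f (r 1) = f (r 0) + (f (r 1) - f (r 0))"
    using r(2) by (intro poly_mapping_eqI) (simp add: lookup_add lookup_minus incseq_def)
  moreover have "r 0 < r 1"
    using r(1) by (simp add: strict_mono_def)
  ultimately show ?thesis by blast
qed

lemma zero_le_exponent: "(0 :: 'v::linorder \<Rightarrow>\<^sub>0 nat) \<le> d"
proof -
  have "\<not> d < 0"
    by transfer (auto simp: less_fun_def)
  then show ?thesis by simp
qed

text \<open>The order is lexicographic and compatible with addition. In a descending chain Dickson's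
  lemma would find a later member that is a multiple of an earlier one, hence not below it.\<close>

lemma wf_exponent_less: "wf {(a, b :: 'v::{finite, linorder} \<Rightarrow>\<^sub>0 nat). a < b}"
  unfolding wf_iff_no_infinite_down_chain
proof safe
  fix f :: "nat \<Rightarrow> ('v \<Rightarrow>\<^sub>0 nat)"
  assume "\<forall>i. (f (Suc i), f i) \<in> {(a, b). a < b}"
  then have dec: "i < j \<Longrightarrow> f j < f i" for i j
    by (induction j) (auto simp: less_Suc_eq intro: less_trans)
  obtain i j d where "i < j" "f j = f i + d"
    using Dickson[of f] by auto
  moreover have "f i \<le> f i + d"
    using add_left_mono[OF zero_le_exponent[of d], of "f i"] by simp
  ultimately show False
    using dec[of i j] by simp
qed

text \<open>If \<open>I\<close> is not finitely generated, elements can be picked forever, each with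
  least leading monomial outside the ideal of the earlier picks. By Dickson's lemma one leading
  monomial divides a later one, and cancelling it contradicts the choice of the later pick.\<close>

theorem noetherian_mpoly:
  "noetherian_ring (mpoly_ring :: ('v::{finite, linorder}, 'k::field) mpoly ring)"
proof (rule ring.noetherian_ringI[OF ring_tring])
  fix I :: "('v, 'k) mpoly set" assume I: "ideal I mpoly_ring"
  define lm :: "('v, 'k) mpoly \<Rightarrow> ('v \<Rightarrow>\<^sub>0 nat)" where "lm f = Max (Poly_Mapping.keys f)" for f
  show "\<exists>A\<subseteq>carrier mpoly_ring. finite A \<and> I = Idl\<^bsub>mpoly_ring\<^esub> A"
  proof (rule ccontr)
    assume contra: "\<not> ?thesis"
    have "\<exists>f. f \<in> I - Idl\<^bsub>mpoly_ring\<^esub> A \<and> (\<forall>g \<in> I - Idl\<^bsub>mpoly_ring\<^esub> A. lm f \<le> lm g)"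
      if "finite A" "A \<subseteq> I" for A
    proof -
      have "Idl\<^bsub>mpoly_ring\<^esub> A \<subseteq> I" "I \<noteq> Idl\<^bsub>mpoly_ring\<^esub> A"
        using Idl_tring(3)[OF I] contra that by auto
      then obtain g where "lm g \<in> lm ` (I - Idl\<^bsub>mpoly_ring\<^esub> A)"
        by blast
      from wfE_min[OF wf_exponent_less this] show ?thesis
        by (metis (no_types, lifting) case_prodI image_iff mem_Collect_eq not_less)
    qed
    then obtain pick where pick: "\<And>A. finite A \<Longrightarrow> A \<subseteq> I \<Longrightarrow>
        pick A \<in> I - Idl\<^bsub>mpoly_ring\<^esub> A \<and> (\<forall>g \<in> I - Idl\<^bsub>mpoly_ring\<^esub> A. lm (pick A) \<le> lm g)"
      by metis
    define G where "G = rec_nat {} (\<lambda>n A. insert (pick A) A)"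
    have G_simps: "G 0 = {}" "\<And>n. G (Suc n) = insert (pick (G n)) (G n)"
      by (simp_all add: G_def)
    have G: "finite (G n) \<and> G n \<subseteq> I" for n
      by (induction n) (use pick in \<open>auto simp: G_simps\<close>)
    have in_G: "pick (G i) \<in> G j" if "i < j" for i j
      using that by (induction j) (auto simp: G_simps less_Suc_eq)
    obtain i j d where ij: "i < j" "lm (pick (G j)) = lm (pick (G i)) + d"
      using Dickson[of "\<lambda>i. lm (pick (G i))"] by auto
    define p q where "p = pick (G i)" and "q = pick (G j)"
    have nz: "p \<noteq> 0" "q \<noteq> 0"
      using pick[of "G i"] pick[of "G j"] G
        ideal_tringD(1)[OF Idl_tring(1)[of "G i"]] ideal_tringD(1)[OF Idl_tring(1)[of "G j"]]
      by (auto simp: p_def q_def)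
    have lm_in: "lm f \<in> Poly_Mapping.keys f" if "f \<noteq> 0" for f
      unfolding lm_def using that by (intro Max_in) auto
    have lm_ge: "m \<le> lm f" if "m \<in> Poly_Mapping.keys f" for m f
      unfolding lm_def using that by (intro Max_ge) auto
    have eq: "lm q = d + lm p"
      using ij(2) by (simp add: p_def q_def add.commute)
    \<comment> \<open>Chosen so that the leading terms of \<open>q\<close> and of
      \<open>single d c * p\<close> cancel.\<close>
    define c where "c = coeff_at q (lm q) / coeff_at p (lm p)"
    define h where "h = q - Poly_Mapping.single d c * p"
    have "p \<in> I" "q \<in> I"
      using pick G by (auto simp: p_def q_def)
    then have "h \<in> I"
      unfolding h_def by (intro ideal_tringD[OF I])
    have "p \<in> Idl\<^bsub>mpoly_ring\<^esub> (G j)"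
      using in_G[OF ij(1)] Idl_tring(2) by (auto simp: p_def)
    then have "Poly_Mapping.single d c * p \<in> Idl\<^bsub>mpoly_ring\<^esub> (G j)"
      by (intro ideal_tringD[OF Idl_tring(1)])
    moreover have "q \<notin> Idl\<^bsub>mpoly_ring\<^esub> (G j)"
      using pick G by (auto simp: q_def)
    ultimately have h: "h \<notin> Idl\<^bsub>mpoly_ring\<^esub> (G j)"
      unfolding h_def using ideal_tringD(2)[OF Idl_tring(1), of h "G j" "Poly_Mapping.single d c * p"]
      by (auto simp: h_def)
    then have "lm q \<le> lm h"
      using pick[of "G j"] G \<open>h \<in> I\<close> by (auto simp: q_def)
    moreover have "h \<noteq> 0"
      using h ideal_tringD(1)[OF Idl_tring(1)[of "G j"]] by auto
    \<comment> \<open>All monomials of \<open>h\<close> lie below the leading monomial of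
      \<open>q\<close>, although \<open>h\<close> was a candidate when \<open>q\<close> was
      picked.\<close>
    moreover have "k < lm q" if "k \<in> Poly_Mapping.keys h" for k
    proof -
      have "coeff_at h (lm q) = 0"
        using lm_in[OF nz(1)] by (simp add: h_def lookup_minus eq lookup_single_mult c_def in_keys_iff)
      then have "k \<noteq> lm q"
        using that by (auto simp: in_keys_iff)
      moreover have "k \<in> Poly_Mapping.keys q \<or> k \<in> Poly_Mapping.keys (Poly_Mapping.single d c * p)"
        using that by (auto simp: h_def in_keys_iff lookup_minus)
      then have "k \<le> lm q"
      proof
        assume "k \<in> Poly_Mapping.keys (Poly_Mapping.single d c * p)"
        then obtain m where "m \<in> Poly_Mapping.keys p" "k = d + m"
          using keys_single_mult by blast
        then show ?thesis
          using lm_ge[of m p] by (simp add: eq add_left_mono)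
      qed (rule lm_ge)
      ultimately show ?thesis by simp
    qed
    ultimately show False
      using lm_in[of h] by force
  qed
qed

section \<open>Counting generators\<close>

text \<open>A monomial form of Nakayama's argument. By \<open>minimal\<close>, no monomial in
  \<open>B\<close> is a proper multiple of one occurring in the ideal, so after projection to the
  coefficients at \<open>B\<close> only constant multipliers matter. The projections of
  \<open>S\<close> therefore span those of the whole ideal, which by \<open>dual\<close> include the
  independent monomials of \<open>B\<close>.\<close>

lemma card_generators_ge:
  fixes S :: "('v, 'k::field) mpoly set"
  assumes "finite S" "finite B"
    and minimal: "\<And>M p M' d. M \<in> B \<Longrightarrow> p \<in> Idl\<^bsub>mpoly_ring\<^esub> S \<Longrightarrow>
          M' \<in> Poly_Mapping.keys p \<Longrightarrow> M = d + M' \<Longrightarrow> d = 0"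
    and dual: "\<And>M. M \<in> B \<Longrightarrow> \<exists>e \<in> Idl\<^bsub>mpoly_ring\<^esub> S. \<forall>M'\<in>B. coeff_at e M' = (if M' = M then 1 else 0)"
  shows "card B \<le> card S"
proof -
  \<comment> \<open>Scalars act through constant polynomials, so that linear independence can be
    used on polynomials directly.\<close>
  interpret vs: vector_space "\<lambda>c (f :: ('v, 'k) mpoly). Poly_Mapping.single 0 c * f"
    by unfold_locales (auto simp: algebra_simps single_add mult_single simp flip: mult.assoc)
  define P :: "('v, 'k) mpoly \<Rightarrow> ('v, 'k) mpoly" where
    "P f = (\<Sum>M\<in>B. Poly_Mapping.single M (coeff_at f M))" for f
  have lookup_P: "coeff_at (P f) M = (if M \<in> B then coeff_at f M else 0)" for f M
    using \<open>finite B\<close> by (auto simp: P_def lookup_sum lookup_single when_def)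
  have P_mult: "P (r * f) = Poly_Mapping.single 0 (coeff_at r 0) * P f"
    if f: "f \<in> Idl\<^bsub>mpoly_ring\<^esub> S" for r f
  proof -
    have "coeff_at (r * f) M = coeff_at r 0 * coeff_at f M" if "M \<in> B" for M
    proof (induction r rule: mpoly_induct)
      case (single d c)
      show ?case
      proof (cases "d = 0")
        case False
        then have "M \<notin> Poly_Mapping.keys (Poly_Mapping.single d c * f)"
          using minimal[OF that f] by (auto dest!: keys_single_mult)
        then show ?thesis
          using False by (simp add: in_keys_iff lookup_single)
      qed (simp add: lookup_const_mult)
    qed (simp add: lookup_add distrib_right)
    then show ?thesis
      by (intro poly_mapping_eqI) (simp add: lookup_P lookup_const_mult)
  qed
  \<comment> \<open>The elements of the ideal whose projection lies in the span form an ideal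
    containing \<open>S\<close>, hence are all of it.\<close>
  define T where "T = {f \<in> Idl\<^bsub>mpoly_ring\<^esub> S. P f \<in> vs.span (P ` S)}"
  have "ideal T mpoly_ring"
  proof (rule ideal_tringI)
    have "P 0 = 0" "\<And>f g. P (f + g) = P f + P g"
      by (auto intro!: poly_mapping_eqI simp: lookup_P lookup_add)
    then show "0 \<in> T" "\<And>x y. x \<in> T \<Longrightarrow> y \<in> T \<Longrightarrow> x + y \<in> T"
      by (auto simp: T_def vs.span_add vs.span_zero intro!: ideal_tringD[OF Idl_tring(1)])
    show "\<And>r x. x \<in> T \<Longrightarrow> r * x \<in> T"
      by (auto simp: T_def P_mult vs.span_scale intro: ideal_tringD(3)[OF Idl_tring(1)])
  qed
  moreover have "S \<subseteq> T"
    using Idl_tring(2) by (auto simp: T_def intro: vs.span_base)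
  ultimately have T: "Idl\<^bsub>mpoly_ring\<^esub> S \<subseteq> T"
    by (rule Idl_tring(3))
  have "mon M \<in> vs.span (P ` S)" if M: "M \<in> B" for M
  proof -
    obtain e where e: "e \<in> Idl\<^bsub>mpoly_ring\<^esub> S" "\<forall>M'\<in>B. coeff_at e M' = (if M' = M then 1 else 0)"
      using dual[OF M] by auto
    then have "P e = mon M"
      using M by (intro poly_mapping_eqI) (auto simp: lookup_P lookup_single when_def)
    then show ?thesis
      using T e(1) by (auto simp: T_def)
  qed
  then have sub: "mon ` B \<subseteq> vs.span (P ` S)"
    by auto
  have "vs.independent (mon ` B :: ('v, 'k) mpoly set)"
  proof (rule vs.independent_if_scalars_zero)
    fix u :: "('v, 'k) mpoly \<Rightarrow> 'k" and x :: "('v, 'k) mpoly"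
    assume u: "(\<Sum>x\<in>mon ` B. Poly_Mapping.single 0 (u x) * x) = 0" and x: "x \<in> mon ` B"
    have "(\<Sum>M\<in>B. Poly_Mapping.single M (u (mon M))) = 0"
      using u by (subst (asm) sum.reindex) (auto simp: inj_on_def mult_single)
    then have z: "coeff_at (\<Sum>M\<in>B. Poly_Mapping.single M (u (mon M))) M' = 0" for M'
      by simp
    have "u (mon M') = 0" if "M' \<in> B" for M'
      using z[of M'] that \<open>finite B\<close> by (simp add: lookup_sum lookup_single when_def)
    then show "u x = 0"
      using x by auto
  qed (use \<open>finite B\<close> in auto)
  then have "card (mon ` B :: ('v, 'k) mpoly set) \<le> card (P ` S)"
    using vs.independent_span_bound[OF _ _ sub] \<open>finite S\<close> by auto
  also have "card (mon ` B :: ('v, 'k) mpoly set) = card B"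
    by (intro card_image inj_onI) simp
  also have "card (P ` S) \<le> card S"
    using \<open>finite S\<close> by (rule card_image_le)
  finally show ?thesis .
qed

section \<open>The tangent cone of a monomial curve\<close>

lemma poly_ideal_principal:
  fixes T :: "'k::field poly set"
  assumes T: "ideal T tring"
  shows "\<exists>r\<in>T. \<forall>t\<in>T. r dvd t"
proof (cases "T = {0}")
  case False
  then obtain t where t: "t \<in> T - {0}"
    using ideal_tringD(1)[OF T] by auto
  define r where "r = (ARG_MIN degree t. t \<in> T - {0})"
  have r: "r \<in> T - {0}" "\<And>t. t \<in> T - {0} \<Longrightarrow> degree r \<le> degree t"
    using arg_min_natI[of "\<lambda>t. t \<in> T - {0}" t degree] arg_min_nat_le[of "\<lambda>t. t \<in> T - {0}" _ degree] t
    by (auto simp: r_def)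
  have "r dvd t" if "t \<in> T" for t
  proof -
    have "t mod r = t - (t div r) * r"
      by (simp add: minus_div_mult_eq_mod)
    then have "t mod r \<in> T"
      using that r(1) ideal_tringD(3)[OF T] ideal_tringD(6)[OF T] by auto
    then have "t mod r = 0"
      using r(2)[of "t mod r"] r(1) degree_mod_less'[of r t] by force
    then show ?thesis by auto
  qed
  then show ?thesis
    using r(1) by auto
qed auto

lemma prod_monom:
  "(\<Prod>i\<in>A. Polynomial.monom (1::'a::comm_semiring_1) (f i)) = Polynomial.monom 1 (\<Sum>i\<in>A. f i)"
  by (induction A rule: infinite_finite_induct) (auto simp: mult_monom)

definition weighted_degree :: "('v::finite \<Rightarrow> nat) \<Rightarrow> ('v \<Rightarrow>\<^sub>0 nat) \<Rightarrow> nat" where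
  "weighted_degree n m = (\<Sum>i\<in>UNIV. n i * Poly_Mapping.lookup m i)"

lemma toric_hom_single:
  "toric_hom n (Poly_Mapping.single m c) = Polynomial.monom c (weighted_degree n m)"
  for c :: "'k::field"
proof -
  have "(\<Prod>i\<in>UNIV. Polynomial.monom (1::'k) (n i) ^ Poly_Mapping.lookup m i) =
      Polynomial.monom 1 (weighted_degree n m)"
    by (simp add: weighted_degree_def monom_power prod_monom)
  then show ?thesis
    by (simp add: toric_hom_eq_eval mpoly_eval_single smult_monom)
qed

lemma toric_ideal_binomial_iff:
  "mon a - mon b \<in> (toric_ideal n :: ('v::finite, 'k::field) mpoly set) \<longleftrightarrow>
     weighted_degree n a = weighted_degree n b"
proof -
  have "mon a - mon b \<in> (toric_ideal n :: ('v, 'k) mpoly set) \<longleftrightarrow>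
      Polynomial.monom (1 :: 'k) (weighted_degree n a) = Polynomial.monom 1 (weighted_degree n b)"
    using toric_hom_single[of n a "1 :: 'k"] toric_hom_single[of n b "1 :: 'k"]
    by (simp add: toric_ideal_def toric_hom_eq_eval mpoly_eval_diff)
  also have "\<dots> \<longleftrightarrow> weighted_degree n a = weighted_degree n b"
    by (auto dest: arg_cong[of _ _ degree] simp: degree_monom_eq)
  finally show ?thesis .
qed

section \<open>Weights, degrees and binomials in the ideal of the tangent cone\<close>

locale monomial_curve =
  fixes n :: "'v::{finite, linorder} \<Rightarrow> nat" and v\<^sub>0 :: 'v and K :: "'k::field itself"
  assumes pos: "0 < n i" and least: "n v\<^sub>0 \<le> n i"
begin

abbreviation cone :: "('v, 'k) mpoly set" where
  "cone \<equiv> tangent_cone_ideal n"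

abbreviation weight :: "('v \<Rightarrow>\<^sub>0 nat) \<Rightarrow> nat" where
  "weight \<equiv> weighted_degree n"

text \<open>Several variables may share the least weight; the monomials in these variables alone are
  those that do not vanish on the reduced tangent cone.\<close>

definition axial :: "('v \<Rightarrow>\<^sub>0 nat) \<Rightarrow> bool" where
  "axial m \<longleftrightarrow> (\<forall>i. n i \<noteq> n v\<^sub>0 \<longrightarrow> Poly_Mapping.lookup m i = 0)"

lemma weight_ge: "n v\<^sub>0 * total_degree m \<le> weight m"
  unfolding weighted_degree_def total_degree_def sum_distrib_left
  by (rule sum_mono) (use least in auto)

lemma weight_eq_iff: "weight m = n v\<^sub>0 * total_degree m \<longleftrightarrow> axial m"
proof
  assume "axial m"
  then show "weight m = n v\<^sub>0 * total_degree m"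
    unfolding weighted_degree_def total_degree_def sum_distrib_left axial_def
    by (intro sum.cong) auto
next
  assume eq: "weight m = n v\<^sub>0 * total_degree m"
  show "axial m"
  proof (rule ccontr)
    assume "\<not> axial m"
    then obtain i where "n i \<noteq> n v\<^sub>0" "Poly_Mapping.lookup m i \<noteq> 0"
      by (auto simp: axial_def)
    then have "n v\<^sub>0 * Poly_Mapping.lookup m i < n i * Poly_Mapping.lookup m i"
      using least[of i] by auto
    then have "n v\<^sub>0 * total_degree m < weight m"
      unfolding weighted_degree_def total_degree_def sum_distrib_left
      by (intro sum_strict_mono_ex1) (use least in auto)
    then show False
      using eq by simp
  qed
qed

lemma ideal_cone: "ideal cone tring"
  unfolding tangent_cone_ideal_def by (rule Idl_tring)

lemma initial_form_in_cone: "f \<in> toric_ideal n \<Longrightarrow> f \<noteq> 0 \<Longrightarrow> initial_form f \<in> cone"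
  unfolding tangent_cone_ideal_def by (rule subsetD[OF Idl_tring(2)]) auto

lemma cone_subsetI:
  assumes "ideal P tring" and "\<And>f. f \<in> toric_ideal n \<Longrightarrow> f \<noteq> 0 \<Longrightarrow> initial_form f \<in> P"
  shows "cone \<subseteq> P"
  unfolding tangent_cone_ideal_def by (rule Idl_tring(3)[OF assms(1)]) (use assms(2) in auto)

lemma cone_binomial_less:
  assumes "weight a = weight b" and "total_degree a < total_degree b"
  shows "mon a \<in> cone"
proof -
  have ab: "a \<noteq> b"
    using assms by auto
  then have "(mon a :: ('v, 'k) mpoly) - mon b \<noteq> 0"
    by simp
  moreover have "initial_form (mon a - mon b :: ('v, 'k) mpoly) = mon a"
    using assms ab
    by (intro initial_form_eqI[of a _ "total_degree a"])
       (auto simp: in_keys_iff lookup_minus lookup_single when_def split: if_splits)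
  ultimately show ?thesis
    using initial_form_in_cone assms(1) toric_ideal_binomial_iff by metis
qed

lemma cone_binomial_eq:
  assumes "weight a = weight b" and "total_degree a = total_degree b"
  shows "mon a - mon b \<in> cone"
proof (cases "a = b")
  case True
  then show ?thesis
    using ideal_tringD(1)[OF ideal_cone] by simp
next
  case ab: False
  then have "(mon a :: ('v, 'k) mpoly) - mon b \<noteq> 0"
    by simp
  moreover have "initial_form (mon a - mon b :: ('v, 'k) mpoly) = mon a - mon b"
    using assms ab
    by (intro initial_form_eqI[of a _ "total_degree a"])
       (auto simp: in_keys_iff lookup_minus lookup_single when_def split: if_splits)
  ultimately show ?thesis
    using initial_form_in_cone assms(1) toric_ideal_binomial_iff by metis
qed

text \<open>The reduced tangent cone is the diagonal line in the coordinates with least \<open>n i\<close>.\<close>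

definition to_line :: "('v, 'k) mpoly \<Rightarrow> 'k poly" where
  "to_line = mpoly_eval (\<lambda>i. if n i = n v\<^sub>0 then Polynomial.monom 1 1 else 0)"

lemma to_line_add: "to_line (p + q) = to_line p + to_line q"
  and to_line_mult: "to_line (p * q) = to_line p * to_line q"
  and to_line_diff: "to_line (p - q) = to_line p - to_line q"
  and to_line_power: "to_line (p ^ k) = to_line p ^ k"
  and to_line_0: "to_line 0 = 0"
  and to_line_1: "to_line 1 = 1"
  by (simp_all add: to_line_def mpoly_eval_add mpoly_eval_mult mpoly_eval_diff mpoly_eval_power)

lemma to_line_single:
  "to_line (Poly_Mapping.single m c) = (if axial m then Polynomial.monom c (total_degree m) else 0)"
proof -
  let ?v = "\<lambda>i. if n i = n v\<^sub>0 then Polynomial.monom 1 1 else (0 :: 'k poly)"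
  have "(\<Prod>i\<in>UNIV. ?v i ^ Poly_Mapping.lookup m i) =
        (if axial m then Polynomial.monom 1 (total_degree m) else 0)"
  proof (cases "axial m")
    case True
    then have "(\<Prod>i\<in>UNIV. ?v i ^ Poly_Mapping.lookup m i) =
        (\<Prod>i\<in>UNIV. Polynomial.monom 1 (Poly_Mapping.lookup m i))"
      by (intro prod.cong) (auto simp: axial_def monom_power)
    then show ?thesis
      using True by (simp add: prod_monom total_degree_def)
  next
    case False
    then obtain i where "n i \<noteq> n v\<^sub>0" "Poly_Mapping.lookup m i \<noteq> 0"
      by (auto simp: axial_def)
    then have "?v i ^ Poly_Mapping.lookup m i = 0"
      by auto
    then have "(\<Prod>i\<in>UNIV. ?v i ^ Poly_Mapping.lookup m i) = 0"
      by (intro prod_zero bexI[of _ i]) auto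
    then show ?thesis
      using False by simp
  qed
  then show ?thesis
    by (simp add: to_line_def mpoly_eval_single smult_monom)
qed

definition axis :: "nat \<Rightarrow> ('v \<Rightarrow>\<^sub>0 nat)" where
  "axis k = Poly_Mapping.single v\<^sub>0 k"

lemma lookup_axis: "Poly_Mapping.lookup (axis k) i = (if i = v\<^sub>0 then k else 0)"
  by (simp add: axis_def lookup_single)

lemma total_degree_axis [simp]: "total_degree (axis k) = k"
  by (simp add: total_degree_def lookup_axis)

lemma axial_axis [simp]: "axial (axis k)"
  by (simp add: axial_def lookup_axis)

lemma axis_eq_iff [simp]: "axis k = axis l \<longleftrightarrow> k = l"
  using total_degree_axis by metis

text \<open>A right inverse of \<open>to_line\<close>, writing \<open>q\<close> in the variable
  \<open>v\<^sub>0\<close>.\<close>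

definition line :: "'k poly \<Rightarrow> ('v, 'k) mpoly" where
  "line q = (\<Sum>i\<le>degree q. Poly_Mapping.single (axis i) (Polynomial.coeff q i))"

lemma to_line_line: "to_line (line q) = q"
proof -
  have "to_line (line q) = (\<Sum>i\<le>degree q. Polynomial.monom (Polynomial.coeff q i) i)"
    unfolding line_def to_line_def mpoly_eval_sum
    by (simp add: to_line_single[unfolded to_line_def])
  then show ?thesis
    by (simp add: poly_as_sum_of_monoms)
qed

text \<open>Let \<open>d\<close> be the least degree in \<open>f\<close>. Among the monomials of
  \<open>f\<close>, the axial ones of degree \<open>d\<close> are exactly those of weight
  \<open>n v\<^sub>0 * d\<close>, since this weight forces degree at most \<open>d\<close>. So the
  restriction of the initial form has as coefficient one of the coefficients of
  \<open>toric_hom n f\<close>, which is 0.\<close>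

lemma cone_subset_kernel: "cone \<subseteq> {p. to_line p = 0}"
proof (rule cone_subsetI)
  show "ideal {p. to_line p = 0} tring"
    unfolding to_line_def by (rule ideal_eval_kernel)
  fix f :: "('v, 'k) mpoly" assume f: "f \<in> toric_ideal n" "f \<noteq> 0"
  define d where "d = Min (total_degree ` Poly_Mapping.keys f)"
  have d: "d \<le> total_degree m" if "m \<in> Poly_Mapping.keys f" for m
    unfolding d_def using that by (intro Min_le) auto
  have "to_line (initial_form f) =
      (\<Sum>m\<in>{m \<in> Poly_Mapping.keys f. total_degree m = d}. to_line (Poly_Mapping.single m (coeff_at f m)))"
    unfolding initial_form_def homogeneous_component_def d_def[symmetric] to_line_def mpoly_eval_sum ..
  also have "\<dots> = (\<Sum>m\<in>{m \<in> Poly_Mapping.keys f. total_degree m = d}.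
      if axial m then Polynomial.monom (coeff_at f m) d else 0)"
    by (intro sum.cong) (auto simp: to_line_single)
  also have "\<dots> = (\<Sum>m\<in>{m \<in> Poly_Mapping.keys f. weight m = n v\<^sub>0 * d}. Polynomial.monom (coeff_at f m) d)"
  proof -
    have "total_degree m = d \<and> axial m \<longleftrightarrow> weight m = n v\<^sub>0 * d" if "m \<in> Poly_Mapping.keys f" for m
    proof
      assume w: "weight m = n v\<^sub>0 * d"
      then have "total_degree m \<le> d"
        using weight_ge[of m] pos[of "v\<^sub>0"] by simp
      then show "total_degree m = d \<and> axial m"
        using d[OF that] w weight_eq_iff[of m] by auto
    qed (use weight_eq_iff in auto)
    then show ?thesis
      by (intro sum.mono_neutral_cong_right) auto
  qed
  also have "\<dots> = Polynomial.monom (Polynomial.coeff (toric_hom n f) (n v\<^sub>0 * d)) d"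
  proof -
    have "toric_hom n f = (\<Sum>m\<in>Poly_Mapping.keys f. Polynomial.monom (coeff_at f m) (weight m))"
      by (subst mpoly_eq_sum_single) (simp add: toric_hom_single mpoly_eval_sum toric_hom_eq_eval flip: toric_hom_single)
    then show ?thesis
      by (simp add: coeff_sum sum.If_cases Int_def conj_commute monom_sum[symmetric])
  qed
  also have "\<dots> = 0"
    using f by (simp add: toric_ideal_def)
  finally show "initial_form f \<in> {p. to_line p = 0}"
    by simp
qed

text \<open>Modulo the radical of \<open>cone\<close>, an axial monomial equals the power of the
  variable \<open>v\<^sub>0\<close> of the same degree, and all other monomials vanish. Thus
  \<open>p\<close> is congruent to its restriction, rewritten in that variable.\<close>

lemma kernel_nilpotent:
  assumes "to_line p = 0"
  shows "\<exists>k. p ^ k \<in> cone"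
proof -
  define Rad where "Rad = {p. \<exists>k. p ^ k \<in> cone}"
  have Rad: "ideal Rad tring"
    unfolding Rad_def by (rule ideal_radical[OF ideal_cone])
  define \<phi> :: "('v \<Rightarrow>\<^sub>0 nat) \<Rightarrow> ('v, 'k) mpoly" where
    "\<phi> m = (if axial m then mon (axis (total_degree m)) else 0)" for m
  have w_axis: "weight (axis k) = n v\<^sub>0 * k" for k
    using weight_eq_iff[of "axis k"] by simp
  have "mon m - \<phi> m \<in> Rad" for m
  proof (cases "axial m")
    case True
    then have "mon m - mon (axis (total_degree m)) \<in> cone"
      by (intro cone_binomial_eq) (auto simp: w_axis weight_eq_iff)
    then show ?thesis
      using True by (auto simp: \<phi>_def Rad_def intro!: exI[of _ 1])
  next
    case False
    \<comment> \<open>The power \<open>n v\<^sub>0\<close> of the monomial has the same weight as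
      the power \<open>weight m\<close> of the variable \<open>v\<^sub>0\<close>, but smaller degree
      because \<open>m\<close> is not axial.\<close>
    define m' where "m' = Poly_Mapping.map ((*) (n v\<^sub>0)) m"
    have lookup_m': "Poly_Mapping.lookup m' i = n v\<^sub>0 * Poly_Mapping.lookup m i" for i
      by (simp add: m'_def Poly_Mapping.map.rep_eq when_def)
    have power: "mon m ^ k = mon (Poly_Mapping.map ((*) k) m)" for k
    proof (induction k)
      case (Suc k)
      have "m + Poly_Mapping.map ((*) k) m = Poly_Mapping.map ((*) (Suc k)) m"
        by (rule poly_mapping_eqI) (simp add: lookup_add Poly_Mapping.map.rep_eq when_def)
      then show ?case
        using Suc by (simp add: mult_single del: mult_Suc)
    next
      case 0
      have "Poly_Mapping.map ((*) 0) m = 0"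
        by (rule poly_mapping_eqI) (simp add: Poly_Mapping.map.rep_eq when_def)
      then show ?case
        by (simp only: power_0 single_one)
    qed
    have "weight m' = weight (axis (weight m))"
      unfolding w_axis by (simp add: weighted_degree_def lookup_m' sum_distrib_left mult_ac)
    moreover have "total_degree m' < total_degree (axis (weight m))"
    proof -
      have "total_degree m' = n v\<^sub>0 * total_degree m"
        by (simp add: total_degree_def lookup_m' sum_distrib_left)
      then show ?thesis
        using False weight_ge[of m] weight_eq_iff[of m] by simp
    qed
    ultimately have "mon m' \<in> cone"
      by (rule cone_binomial_less)
    then show ?thesis
      using False by (auto simp: Rad_def \<phi>_def m'_def power intro!: exI[of _ "n v\<^sub>0"])
  qed
  then have "p - linear_ext \<phi> p \<in> Rad"
    by (rule diff_linear_ext_mem[OF Rad])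
  moreover have "linear_ext \<phi> p = 0"
  proof (rule poly_mapping_eqI)
    fix m
    \<comment> \<open>\<open>linear_ext \<phi> p\<close> only has monomials on the axis, with the
      coefficients of \<open>to_line p\<close>; these vanish by assumption.\<close>
    have 1: "coeff_at (linear_ext \<phi> p) (axis d) = Polynomial.coeff (to_line p) d" for d
      by (induction p rule: mpoly_induct)
         (auto simp: linear_ext_add linear_ext_single \<phi>_def lookup_add to_line_single mult_single
           lookup_single when_def to_line_add)
    have 2: "coeff_at (linear_ext \<phi> p) m = 0" if "m \<notin> range axis"
      using that by (induction p rule: mpoly_induct)
         (auto simp: linear_ext_add linear_ext_single \<phi>_def lookup_add mult_single lookup_single when_def)
    show "coeff_at (linear_ext \<phi> p) m = coeff_at 0 m"
      using 1 2 assms by (cases "m \<in> range axis") auto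
  qed
  ultimately show ?thesis
    by (simp add: Rad_def)
qed

section \<open>Prime ideals containing the ideal of the tangent cone\<close>

lemma ideal_to_line_image:
  assumes "ideal P tring"
  shows "ideal (to_line ` P) tring"
proof (rule ideal_tringI)
  show "0 \<in> to_line ` P"
    using ideal_tringD(1)[OF assms] by (auto simp: to_line_def intro!: image_eqI[of _ _ 0])
  show "x + y \<in> to_line ` P" if "x \<in> to_line ` P" "y \<in> to_line ` P" for x y
    using that ideal_tringD(2)[OF assms] by (auto simp: to_line_def simp flip: mpoly_eval_add)
  show "r * x \<in> to_line ` P" if x: "x \<in> to_line ` P" for r x
  proof -
    obtain p where "p \<in> P" "x = to_line p"
      using x by auto
    then show ?thesis
      using ideal_tringD(3)[OF assms, of p "line r"]
      by (intro image_eqI[of _ _ "line r * p"]) (simp_all add: to_line_def mpoly_eval_mult to_line_line[unfolded to_line_def])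
  qed
qed

lemma prime_kernel: "primeideal {p. to_line p = 0} tring"
  by (rule primeideal_tringI)
     (use ideal_eval_kernel in \<open>auto simp: to_line_def mpoly_eval_mult\<close>)

context
  fixes P :: "('v, 'k) mpoly set"
  assumes P: "primeideal P tring" and cone_le: "cone \<subseteq> P"
begin

text \<open>A prime ideal containing \<open>cone\<close> contains everything nilpotent modulo
  \<open>cone\<close>, so it is determined by its image in \<open>K[t]\<close>.\<close>

lemma kernel_subset_prime: "{p. to_line p = 0} \<subseteq> P"
  using kernel_nilpotent primeideal_tringD(4)[OF P] cone_le by blast

lemma to_line_mem_image_iff: "to_line p \<in> to_line ` P \<longleftrightarrow> p \<in> P"
proof
  assume "to_line p \<in> to_line ` P"
  then obtain q where q: "q \<in> P" "to_line p = to_line q"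
    by auto
  then have "p - q \<in> P"
    using kernel_subset_prime by (auto simp: to_line_diff)
  then show "p \<in> P"
    using ideal_tringD(2)[OF primeideal_tringD(1)[OF P] _ q(1)] by fastforce
qed auto

lemma prime_generator:
  obtains r where "\<And>p. p \<in> P \<longleftrightarrow> r dvd to_line p"
proof -
  obtain r where r: "r \<in> to_line ` P" "\<And>t. t \<in> to_line ` P \<Longrightarrow> r dvd t"
    using poly_ideal_principal[OF ideal_to_line_image[OF primeideal_tringD(1)[OF P]]] by auto
  have "p \<in> P \<longleftrightarrow> r dvd to_line p" for p
  proof
    assume "r dvd to_line p"
    then obtain q where "to_line p = q * r"
      by (metis dvdE mult.commute)
    then have "to_line p \<in> to_line ` P"
      using ideal_tringD(3)[OF ideal_to_line_image[OF primeideal_tringD(1)[OF P]] r(1), of q] by simp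
    then show "p \<in> P"
      by (simp add: to_line_mem_image_iff)
  qed (use r(2) in auto)
  then show thesis by (rule that)
qed

end

text \<open>In \<open>K[t]\<close> a nonzero prime is not properly contained in another: if its
  generator \<open>r\<close> is \<open>s * c\<close>, then \<open>r\<close> divides
  \<open>s\<close>, giving equality, or \<open>r\<close> divides \<open>c\<close>, making
  \<open>s\<close> a unit.\<close>

lemma prime_chain_trivial:
  assumes P: "primeideal P tring" "cone \<subseteq> P" and Q: "primeideal Q tring" "cone \<subseteq> Q" "P \<subset> Q"
  shows "P = {p. to_line p = 0}"
proof (rule ccontr)
  assume ne: "P \<noteq> {p. to_line p = 0}"
  obtain r where r: "\<And>p. p \<in> P \<longleftrightarrow> r dvd to_line p"
    using prime_generator[OF P] by blast
  obtain s where s: "\<And>p. p \<in> Q \<longleftrightarrow> s dvd to_line p"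
    using prime_generator[OF Q(1,2)] by blast
  have "r \<noteq> 0"
  proof
    assume "r = 0"
    then have "P = {p. to_line p = 0}"
      by (simp add: set_eq_iff r)
    then show False
      using ne by simp
  qed
  have "line r \<in> P"
    by (simp add: r to_line_line)
  then have "s dvd r"
    using Q(3) s[of "line r"] by (auto simp: to_line_line)
  then obtain c where c: "r = s * c"
    by auto
  have "line s * line c \<in> P"
    by (simp add: r to_line_line to_line_mult c)
  then have "r dvd s \<or> r dvd c"
    using primeideal_tringD(3)[OF P(1), of "line s" "line c"] by (simp add: r to_line_line)
  then show False
  proof
    assume "r dvd s"
    then have "Q \<subseteq> P"
      using dvd_trans[OF \<open>r dvd s\<close>] by (auto simp: r s)
    then show False
      using Q(3) by auto
  next
    assume "r dvd c"
    then have "s * c dvd 1 * c"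
      by (simp add: c)
    then have "s dvd 1"
      using \<open>r \<noteq> 0\<close> c by (simp only: dvd_mult_cancel_right) auto
    then have "1 \<in> Q"
      by (simp add: s to_line_1)
    then show False
      using primeideal_tringD(2)[OF Q(1)] by auto
  qed
qed

abbreviation pr :: "('v, 'k) mpoly \<Rightarrow> ('v, 'k) mpoly set" where
  "pr \<equiv> proj cone"

lemma ideal_origin: "ideal {p. Polynomial.coeff (to_line p) 0 = 0} tring"
  by (rule ideal_tringI) (auto simp: to_line_add to_line_mult coeff_mult_0 to_line_0)

lemma maximal_tring_imp_prime:
  "maximalideal P (tring :: 'a::comm_ring_1 ring) \<Longrightarrow> primeideal P tring"
  by (rule cring.maximalideal_prime[OF cring_tring])

text \<open>The ideal of the origin lies strictly between the kernel and the whole ring. Hence the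
  generator on the line of a maximal ideal over \<open>cone\<close> is nonzero.\<close>

lemma kernel_not_maximal: "\<not> maximalideal {p. to_line p = 0} tring"
proof
  let ?O = "{p. Polynomial.coeff (to_line p) 0 = 0}"
  assume max: "maximalideal {p. to_line p = 0} tring"
  have "?O = {p. to_line p = 0} \<or> ?O = carrier tring"
    by (rule maximalideal.I_maximal[OF max ideal_origin]) auto
  moreover have "line (Polynomial.monom 1 1) \<in> ?O" "line (Polynomial.monom 1 1) \<notin> {p. to_line p = 0}"
    by (simp_all add: to_line_line)
  moreover have "1 \<notin> ?O"
    by (simp add: to_line_1)
  ultimately show False
    unfolding tring_simps by blast
qed

section \<open>Height and depth at a maximal ideal\<close>

context
  fixes M :: "('v, 'k) mpoly set set"
  assumes M: "maximalideal M (tring Quot cone)"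
begin

lemma vimage_prime: "primeideal (pr -` M) tring" and cone_subset_vimage: "cone \<subseteq> pr -` M"
  using maximal_tring_imp_prime[OF maximalideal_proj_vimage[OF ideal_cone M]]
    ideal_proj_vimage(2)[OF ideal_cone maximalideal.axioms(1)[OF M]] by auto

lemma vimage_generator:
  obtains r where "r \<noteq> 0" "\<And>p. pr p \<in> M \<longleftrightarrow> r dvd to_line p"
proof -
  obtain r where r: "\<And>p. p \<in> pr -` M \<longleftrightarrow> r dvd to_line p"
    using prime_generator[OF vimage_prime cone_subset_vimage] by blast
  have "r \<noteq> 0"
  proof
    assume "r = 0"
    then have "pr -` M = {p. to_line p = 0}"
      using r by (simp only: set_eq_iff) simp
    then show False
      using kernel_not_maximal maximalideal_proj_vimage[OF ideal_cone M] by auto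
  qed
  then show thesis
    using that r by auto
qed

lemma maximal_height: "prime_height (tring Quot cone) M = 1"
proof -
  let ?S = "tring Quot cone"
  define H where
    "H = {h. \<exists>Q. (\<forall>i \<le> h. primeideal (Q i) ?S) \<and> (\<forall>i < h. Q i \<subset> Q (Suc i)) \<and> Q h = M}"
  let ?N = "pr ` {p. to_line p = 0}"
  have le: "h \<le> 1" if hH: "h \<in> H" for h
  proof (rule ccontr)
    assume "\<not> h \<le> 1"
    then have h: "2 \<le> h" by simp
    obtain Q where Q: "\<And>i. i \<le> h \<Longrightarrow> primeideal (Q i) ?S" "\<And>i. i < h \<Longrightarrow> Q i \<subset> Q (Suc i)"
      using hH unfolding H_def by blast
    note prime = primeideal_proj_vimage[OF ideal_cone Q(1)]
    note vim = ideal_proj_vimage[OF ideal_cone primeideal.axioms(1)[OF Q(1)]]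
    have less: "pr -` Q i \<subset> pr -` Q (Suc i)" if "i < h" for i
    proof
      show "pr -` Q i \<subseteq> pr -` Q (Suc i)"
        using Q(2)[OF that] by blast
      show "pr -` Q i \<noteq> pr -` Q (Suc i)"
      proof
        assume eq: "pr -` Q i = pr -` Q (Suc i)"
        have "Q i = pr ` (pr -` Q i)"
          using that by (intro vim(3)) simp
        also have "\<dots> = pr ` (pr -` Q (Suc i))"
          by (rule arg_cong[OF eq])
        also have "\<dots> = Q (Suc i)"
          using that by (intro vim(3)[symmetric]) simp
        finally show False
          using Q(2)[OF that] by simp
      qed
    qed
    \<comment> \<open>In a chain with two strict inclusions, both of the lower members would have to
      be the kernel.\<close>
    have "pr -` Q 0 = {p. to_line p = 0}"
      by (rule prime_chain_trivial[OF prime[of 0] vim(2)[of 0] prime[of 1] vim(2)[of 1]]) (use less[of 0] h in simp_all)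
    moreover have "pr -` Q 1 = {p. to_line p = 0}"
      by (rule prime_chain_trivial[OF prime[of 1] vim(2)[of 1] prime[of 2] vim(2)[of 2]])
         (use less[of 1] h in \<open>simp_all add: numeral_2_eq_2\<close>)
    ultimately show False
      using less[of 0] h by simp
  qed
  have one: "1 \<in> H"
  proof -
    obtain r where r: "r \<noteq> 0" "\<And>p. pr p \<in> M \<longleftrightarrow> r dvd to_line p"
      using vimage_generator by blast
    have less: "?N \<subset> M"
    proof
      show "?N \<subseteq> M"
        by (rule image_subsetI) (simp add: r(2))
      have in_M: "pr (line r) \<in> M"
        by (simp add: r(2) to_line_line)
      have "line r \<notin> {p. to_line p = 0}"
        using \<open>r \<noteq> 0\<close> by (simp add: to_line_line)
      then have "pr (line r) \<notin> ?N"
        by (subst proj_in_image_iff[OF ideal_cone primeideal_tringD(1)[OF prime_kernel] cone_subset_kernel])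
      with in_M show "?N \<noteq> M"
        by metis
    qed
    \<comment> \<open>The kernel below \<open>M\<close> is a chain with one inclusion.\<close>
    define Q where "Q = case_nat ?N (\<lambda>_. M)"
    have Q0: "Q 0 = ?N" and Q1: "Q (Suc 0) = M"
      by (simp_all only: Q_def nat.case)
    have prime: "primeideal (Q i) ?S" for i
      unfolding Q_def
      using primeideal_proj_image[OF ideal_cone prime_kernel cone_subset_kernel]
        cring.maximalideal_prime[OF cring_quot[OF ideal_cone] M]
      by (simp split: nat.split)
    have "Q i \<subset> Q (Suc i)" if "i < 1" for i
    proof -
      have "i = 0"
        using that by simp
      then show ?thesis
        using less by (simp only: Q0 Q1)
    qed
    then show ?thesis
      unfolding H_def using prime Q1 by (intro CollectI exI[of _ Q]) simp
  qed
  have "(SUP h\<in>H. enat h) = 1"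
  proof (rule antisym)
    show "(SUP h\<in>H. enat h) \<le> 1"
      by (rule SUP_least) (use le in \<open>simp add: one_enat_def\<close>)
    show "1 \<le> (SUP h\<in>H. enat h)"
      by (rule SUP_upper2[OF one]) (simp add: one_enat_def)
  qed
  then show ?thesis
    unfolding prime_height_def H_def .
qed

text \<open>The bound is obtained directly from the restriction to the line. If \<open>p\<close>,
  \<open>q\<close> started a regular sequence in \<open>M\<close>, the part of \<open>p\<close> not
  absorbed by powers of \<open>q\<close> would survive outside \<open>M\<close>; regularity of
  \<open>q\<close> modulo \<open>p\<close> then forces a power of it into the ideal of
  \<open>p\<close>, which lies in \<open>M\<close>.\<close>

lemma regular_sequence_length_le_1:
  assumes xs: "regular_sequence (tring Quot cone) xs" "set xs \<subseteq> M"
  shows "length xs \<le> 1"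
proof (rule ccontr)
  assume len: "\<not> length xs \<le> 1"
  obtain x y zs where xs_eq: "xs = x # y # zs"
    using len by (cases xs; cases "tl xs") auto
  obtain p q where pq: "x = pr p" "y = pr q"
    using xs(1) by (auto simp: regular_sequence_def xs_eq carrier_quot[OF ideal_cone])
  have "pr p \<in> M" "pr q \<in> M"
    using xs(2) pq by (auto simp: xs_eq)
  obtain r where r: "r \<noteq> 0" "\<And>p. pr p \<in> M \<longleftrightarrow> r dvd to_line p"
    using vimage_generator by blast
  have r_unit: "\<not> r dvd 1"
    using r(2)[of 1] primeideal_tringD(2)[OF vimage_prime] by (auto simp: to_line_1)
  have cone_iff: "pr u = pr 0 \<longleftrightarrow> u \<in> cone" for u
    by (simp add: proj_eq_iff[OF ideal_cone])
  have reg1: "z \<in> cone" if "p * z \<in> cone" for z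
    using xs(1) that unfolding regular_sequence_def xs_eq
    by (auto simp: pq quot_simps[OF ideal_cone] Idl_quot_empty[OF ideal_cone] cone_iff
      dest!: spec[of _ 0] bspec[of _ _ "pr z"])
  have reg2: "\<exists>w. z - w * p \<in> cone" if "q * z - w * p \<in> cone" for z w
  proof -
    have "pr (q * z) \<in> Idl\<^bsub>tring Quot cone\<^esub> {pr p}"
      using that Idl_quot_singleton[OF ideal_cone] by auto
    moreover have "\<forall>y\<in>carrier (tring Quot cone). pr q \<otimes>\<^bsub>tring Quot cone\<^esub> y \<in> Idl\<^bsub>tring Quot cone\<^esub> {pr p}
        \<longrightarrow> y \<in> Idl\<^bsub>tring Quot cone\<^esub> {pr p}"
      using xs(1) unfolding regular_sequence_def xs_eq by (auto simp: pq dest!: spec[of _ "Suc 0"])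
    ultimately have "pr z \<in> Idl\<^bsub>tring Quot cone\<^esub> {pr p}"
      by (auto simp: quot_simps[OF ideal_cone])
    then show ?thesis
      using Idl_quot_singleton[OF ideal_cone] by auto
  qed
  have reg2_power: "\<exists>w. z - w * p \<in> cone" if "q ^ k * z - w * p \<in> cone" for z w k
    using that
  proof (induction k arbitrary: w)
    case (Suc k)
    then show ?case
      using reg2[of "q ^ k * z" w] by (auto simp: mult_ac)
  qed auto
  \<comment> \<open>Otherwise \<open>p\<close> is nilpotent modulo \<open>cone\<close>, and
    cancelling its factors one by one puts 1 into \<open>cone\<close>.\<close>
  have p_nz: "to_line p \<noteq> 0"
  proof
    assume "to_line p = 0"
    then obtain k where "p ^ k \<in> cone"
      using kernel_nilpotent by blast
    then have "1 \<in> cone"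
      by (induction k) (auto dest: reg1)
    then show False
      using cone_subset_vimage primeideal_tringD(2)[OF vimage_prime] by auto
  qed
  \<comment> \<open>These are the multipliers that make some power of \<open>q\<close> divisible by
    \<open>p\<close> on the line; one of least degree has no factor \<open>r\<close> left.\<close>
  define D where "D = {s. s \<noteq> 0 \<and> (\<exists>e. to_line p dvd s * to_line q ^ e)}"
  have "to_line p \<in> D"
    using p_nz by (auto simp: D_def intro: exI[of _ 0])
  define s where "s = (ARG_MIN degree s. s \<in> D)"
  have s: "s \<in> D" "\<And>t. t \<in> D \<Longrightarrow> degree s \<le> degree t"
    using arg_min_natI[of "\<lambda>t. t \<in> D" _ degree] arg_min_nat_le[of "\<lambda>t. t \<in> D" _ degree] \<open>to_line p \<in> D\<close>
    by (auto simp: s_def)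
  obtain e where e: "to_line p dvd s * to_line q ^ e"
    using s(1) by (auto simp: D_def)
  \<comment> \<open>A factor \<open>r\<close> of \<open>s\<close> could be traded for one more
    factor \<open>to_line q\<close>, which \<open>r\<close> divides, giving a member of
    \<open>D\<close> of smaller degree.\<close>
  have "\<not> r dvd s"
  proof
    assume "r dvd s"
    then obtain s' where s': "s = r * s'" by auto
    obtain q' where q': "to_line q = r * q'"
      using r(2)[of q] \<open>pr q \<in> M\<close> by auto
    have "s' * to_line q ^ Suc e = q' * (s * to_line q ^ e)"
      by (simp add: s' q' mult_ac)
    then have "to_line p dvd s' * to_line q ^ Suc e"
      using dvd_mult[OF e, of q'] by (simp only:)
    then have "s' \<in> D"
      using s(1) s' unfolding D_def by (intro CollectI conjI exI[of _ "Suc e"]) auto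
    then have "degree s \<le> degree s'"
      by (rule s(2))
    moreover have "degree r \<noteq> 0"
      using r_unit r(1) is_unit_iff_degree by blast
    ultimately show False
      using s(1) s' by (auto simp: D_def degree_mult_eq)
  qed
  obtain c where c: "s * to_line q ^ e = to_line p * c"
    using e by auto
  \<comment> \<open>The divisibility on the line lifts to the quotient ring only up to the nilpotent
    error \<open>\<delta>\<close>, which a power removes.\<close>
  define \<delta> where "\<delta> = q ^ e * line s - p * line c"
  have "to_line \<delta> = 0"
    using c by (simp add: \<delta>_def to_line_diff to_line_mult to_line_power to_line_line mult.commute)
  then obtain m where m: "\<delta> ^ m \<in> cone"
    using kernel_nilpotent by blast
  have "\<exists>w. (q ^ e * line s) ^ m - \<delta> ^ m = w * p"
  proof -
    have "q ^ e * line s - \<delta> dvd (q ^ e * line s) ^ m - \<delta> ^ m"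
      unfolding power_diff_sumr2 by simp
    then have "p dvd (q ^ e * line s) ^ m - \<delta> ^ m"
      by (auto simp: \<delta>_def intro: dvd_trans[rotated])
    then show ?thesis
      by (auto simp: dvd_def mult.commute)
  qed
  then obtain w where "(q ^ e * line s) ^ m - w * p = \<delta> ^ m"
    by (auto simp: algebra_simps)
  \<comment> \<open>Regularity of \<open>q\<close> modulo \<open>p\<close> now cancels the power of
    \<open>q\<close>, so a power of \<open>line s\<close> lies in the ideal of \<open>p\<close> and
    thus in \<open>M\<close>.\<close>
  then have "q ^ (e * m) * line s ^ m - w * p \<in> cone"
    using m by (simp add: power_mult_distrib power_mult)
  then obtain w where "line s ^ m - w * p \<in> cone"
    using reg2_power by blast
  then have "to_line (line s ^ m - w * p) = 0"
    using cone_subset_kernel by auto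
  then have "s ^ m = to_line w * to_line p"
    by (simp add: to_line_diff to_line_mult to_line_power to_line_line)
  moreover have "r dvd to_line p"
    using r(2) \<open>pr p \<in> M\<close> by auto
  ultimately have "pr (line s ^ m) \<in> M"
    by (simp add: r(2) to_line_power to_line_line)
  then have "pr (line s) \<in> M"
    using primeideal_tringD(4)[OF vimage_prime] by auto
  then show False
    using \<open>\<not> r dvd s\<close> by (simp add: r(2) to_line_line)
qed

end

text \<open>The hypothesis is torsion-freeness over the polynomials in the variable
  \<open>v\<^sub>0\<close>. For \<open>r\<close> generating \<open>M\<close> on the line,
  \<open>line r\<close> is an element of \<open>M\<close> and a nonzerodivisor, so the depth reaches
  the height 1.\<close>

theorem cohen_macaulay_cone:
  assumes reg: "\<And>r z. r \<noteq> 0 \<Longrightarrow> line r * z \<in> cone \<Longrightarrow> z \<in> cone"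
  shows "cohen_macaulay_tangent_cone K n"
  unfolding cohen_macaulay_tangent_cone_def cohen_macaulay_ring_def
proof (intro conjI allI impI)
  let ?S = "tring Quot cone"
  show "cring ?S"
    by (rule cring_quot[OF ideal_cone])
  show "noetherian_ring ?S"
    by (rule noetherian_quot[OF ideal_cone noetherian_mpoly])
  fix M assume M: "maximalideal M ?S"
  obtain r where r: "r \<noteq> 0" "\<And>p. pr p \<in> M \<longleftrightarrow> r dvd to_line p"
    using vimage_generator[OF M] by blast
  have in_M: "pr (line r) \<in> M"
    by (simp add: r to_line_line)
  have iff: "pr u = pr 0 \<longleftrightarrow> u \<in> cone" for u
    by (simp add: proj_eq_iff[OF ideal_cone])
  have "Idl\<^bsub>?S\<^esub> {pr (line r)} \<subseteq> M"
    using in_M by (intro ring.genideal_minimal ring_quot ideal_cone maximalideal.axioms(1)[OF M]) auto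
  then have "Idl\<^bsub>?S\<^esub> {pr (line r)} \<noteq> carrier ?S"
    using maximalideal.I_notcarr[OF M] ideal.Icarr[OF maximalideal.axioms(1)[OF M]] by blast
  then have "regular_sequence ?S [pr (line r)]"
    using reg[OF r(1)]
    by (auto simp: regular_sequence_def Idl_quot_empty[OF ideal_cone] carrier_quot[OF ideal_cone]
      quot_simps[OF ideal_cone] iff)
  then have "1 \<le> ideal_depth ?S M"
    using in_M unfolding ideal_depth_def
    by (intro SUP_upper2[of "[pr (line r)]"]) (auto simp: one_enat_def)
  moreover have "ideal_depth ?S M \<le> 1"
    unfolding ideal_depth_def
    by (intro SUP_least) (use regular_sequence_length_le_1[OF M] in \<open>auto simp: one_enat_def\<close>)
  ultimately show "ideal_depth ?S M = prime_height ?S M"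
    using maximal_height[OF M] by simp
qed

text \<open>The annihilator of \<open>c\<close> contains a power of the variable
  \<open>v\<^sub>0\<close>, and together with the nilpotents this variable generates the ideal of
  the origin. So every element of that ideal has a power killing \<open>c\<close>, and the depth
  there is 0 while the height is 1.\<close>

theorem not_cohen_macaulay_cone:
  assumes c: "c \<notin> cone" "mon (axis k) * c \<in> cone"
  shows "\<not> cohen_macaulay_tangent_cone K n"
proof
  let ?S = "tring Quot cone"
  assume cm: "cohen_macaulay_tangent_cone K n"
  define O' where "O' = {p. Polynomial.coeff (to_line p) 0 = 0}"
  define M where "M = pr ` O'"
  have O': "ideal O' tring" "cone \<subseteq> O'"
    using ideal_origin cone_subset_kernel by (auto simp: O'_def)
  have "maximalideal O' tring"
  proof (rule maximalidealI)
    show "carrier tring \<noteq> O'"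
      by (auto simp: O'_def set_eq_iff intro!: exI[of _ 1] simp: to_line_1)
    fix P :: "('v, 'k) mpoly set" assume P: "ideal P tring" "O' \<subseteq> P"
    show "P = O' \<or> P = carrier tring"
    proof (rule disjCI)
      assume "P \<noteq> carrier tring"
      then have "1 \<notin> P"
        using ideal_tring_eq_UNIV[OF P(1)] by auto
      have "p \<in> O'" if "p \<in> P" for p
      proof (rule ccontr)
        assume "p \<notin> O'"
        \<comment> \<open>Subtracting the constant term moves \<open>p\<close> into the ideal of the
          origin, so \<open>P\<close> contains the unit \<open>a\<close>.\<close>
        define a where "a = Polynomial.coeff (to_line p) 0"
        have "a \<noteq> 0"
          using \<open>p \<notin> O'\<close> by (simp add: O'_def a_def)
        have "to_line (Poly_Mapping.single 0 a) = Polynomial.monom a 0"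
          using to_line_single[of 0 a] by (simp add: axial_def total_degree_def)
        then have "p - Poly_Mapping.single 0 a \<in> P"
          using P(2) by (auto simp: O'_def to_line_diff a_def)
        then have "Poly_Mapping.single 0 a \<in> P"
          using ideal_tringD(6)[OF P(1) that] by fastforce
        then have "Poly_Mapping.single 0 (inverse a) * Poly_Mapping.single 0 a \<in> P"
          by (rule ideal_tringD[OF P(1)])
        then show False
          using \<open>a \<noteq> 0\<close> \<open>1 \<notin> P\<close> by (simp add: mult_single)
      qed
      then show "P = O'"
        using P(2) by auto
    qed
  qed (rule O')
  then have M: "maximalideal M ?S"
    unfolding M_def using O'(2) by (intro maximalideal_proj_image ideal_cone)
  define C where "C = {p. c * p \<in> cone}"
  define Rad where "Rad = {p. \<exists>k. p ^ k \<in> C}"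
  have C: "ideal C tring"
    unfolding C_def by (rule ideal_colon[OF ideal_cone])
  have Rad: "ideal Rad tring"
    unfolding Rad_def by (rule ideal_radical[OF C])
  have "(mon (axis 1) :: ('v, 'k) mpoly) ^ k = mon (axis k)"
    by (induction k) (auto simp: mult_single axis_def simp flip: single_add)
  then have "c * mon (axis 1) ^ k \<in> cone"
    using c(2) by (simp only: mult.commute)
  then have axis_Rad: "mon (axis 1) \<in> Rad"
    unfolding Rad_def C_def by blast
  have "O' \<subseteq> Rad"
  proof
    fix p assume "p \<in> O'"
    \<comment> \<open>The restriction has no constant term, so it is divisible by \<open>t\<close>;
      hence \<open>p\<close> is a multiple of the variable \<open>v\<^sub>0\<close> up to an element
      of the kernel.\<close>
    then obtain q where q: "to_line p = Polynomial.monom 1 1 * q"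
      by (cases "to_line p") (auto simp: O'_def monom_altdef)
    have "to_line (p - mon (axis 1) * line q) = 0"
      by (simp add: to_line_diff to_line_mult to_line_line to_line_single q)
    then have "p - mon (axis 1) * line q \<in> Rad"
      using kernel_nilpotent by (auto simp: Rad_def C_def intro!: ideal_tringD(3)[OF ideal_cone])
    moreover have "mon (axis 1) * line q \<in> Rad"
      using axis_Rad by (rule ideal_tringD(4)[OF Rad])
    ultimately show "p \<in> Rad"
      using ideal_tringD(2)[OF Rad] by fastforce
  qed
  have iff: "pr u = pr 0 \<longleftrightarrow> u \<in> cone" for u
    by (simp add: proj_eq_iff[OF ideal_cone])
  have "xs = []" if xs: "regular_sequence ?S xs" "set xs \<subseteq> M" for xs
  proof (cases xs)
    case (Cons x ys)
    then obtain p where p: "x = pr p" "p \<in> O'"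
      using xs(2) by (auto simp: M_def)
    have reg: "z \<in> cone" if "p * z \<in> cone" for z
      using xs(1) that unfolding regular_sequence_def Cons
      by (auto simp: p(1) quot_simps[OF ideal_cone] Idl_quot_empty[OF ideal_cone] iff
        dest!: spec[of _ 0] bspec[of _ _ "pr z"])
    \<comment> \<open>If \<open>p\<close> were regular, its \<open>l\<close> factors could be
      cancelled one by one, putting \<open>c\<close> into \<open>cone\<close>.\<close>
    obtain l where "p ^ l * c \<in> cone"
      using p(2) \<open>O' \<subseteq> Rad\<close> by (auto simp: Rad_def C_def mult.commute)
    then have "c \<in> cone"
      by (induction l) (auto simp: mult.assoc intro: reg)
    then show ?thesis
      using c(1) by simp
  qed
  then have "ideal_depth ?S M \<le> 0"
    unfolding ideal_depth_def by (intro SUP_least) (auto simp: zero_enat_def)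
  moreover have "ideal_depth ?S M = 1"
    using cm M maximal_height[OF M]
    by (simp add: cohen_macaulay_tangent_cone_def cohen_macaulay_ring_def)
  ultimately show False
    by simp
qed

end

section \<open>Normal forms for the three binomials\<close>

lemma UNIV_4: "(UNIV :: 4 set) = {1, 2, 3, 4}"
proof -
  have "card {1, 2, 3, 4 :: 4} = CARD(4)"
    by simp
  then show ?thesis
    by (intro card_subset_eq[symmetric]) auto
qed

lemma exhaust_4: "i = 1 \<or> i = 2 \<or> i = 3 \<or> i = (4 :: 4)"
  using UNIV_4 by auto

definition expo :: "nat \<Rightarrow> nat \<Rightarrow> nat \<Rightarrow> nat \<Rightarrow> (4 \<Rightarrow>\<^sub>0 nat)" where
  "expo i j k l = Poly_Mapping.single 1 i + Poly_Mapping.single 2 j + Poly_Mapping.single 3 k + Poly_Mapping.single 4 l"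

lemma lookup_expo [simp]:
  "Poly_Mapping.lookup (expo i j k l) 1 = i"
  "Poly_Mapping.lookup (expo i j k l) 2 = j"
  "Poly_Mapping.lookup (expo i j k l) 3 = k"
  "Poly_Mapping.lookup (expo i j k l) 4 = l"
  by (simp_all add: expo_def lookup_add lookup_single)

lemma expo_cases: obtains i j k l where "m = expo i j k l"
proof
  show "m = expo (Poly_Mapping.lookup m 1) (Poly_Mapping.lookup m 2) (Poly_Mapping.lookup m 3) (Poly_Mapping.lookup m 4)"
  proof (rule poly_mapping_eqI)
    fix v :: 4
    show "Poly_Mapping.lookup m v = Poly_Mapping.lookup (expo (Poly_Mapping.lookup m 1) (Poly_Mapping.lookup m 2)
        (Poly_Mapping.lookup m 3) (Poly_Mapping.lookup m 4)) v"
      using exhaust_4[of v] by (elim disjE; hypsubst; simp only: lookup_expo)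
  qed
qed

lemma expo_eq_iff [simp]: "expo i j k l = expo i' j' k' l' \<longleftrightarrow> i = i' \<and> j = j' \<and> k = k' \<and> l = l'"
  by (metis lookup_expo)

lemma expo_0 [simp]: "expo 0 0 0 0 = 0"
  by (simp add: expo_def)

lemma expo_eq_0_iff [simp]: "expo i j k l = 0 \<longleftrightarrow> i = 0 \<and> j = 0 \<and> k = 0 \<and> l = 0"
  by (metis expo_eq_iff expo_0)

lemma expo_add [simp]: "expo i j k l + expo i' j' k' l' = expo (i + i') (j + j') (k + k') (l + l')"
  by (simp add: expo_def single_add ac_simps)

lemma total_degree_expo [simp]: "total_degree (expo i j k l) = i + j + k + l"
  unfolding total_degree_def UNIV_4 by (simp add: lookup_expo[simplified])

text \<open>The coefficient is a sum over a fibre of \<open>N\<close>. The condition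
  \<open>P\<close> is trivial for ordinary normal forms; later it keeps the monomials whose degree
  does not change.\<close>

lemma lookup_linear_ext_mon:
  "coeff_at (linear_ext (\<lambda>m. if P m then mon (N m) else 0) f) r =
     (\<Sum>m\<in>{m \<in> Poly_Mapping.keys f. P m \<and> N m = r}. coeff_at f m)"
proof -
  have "coeff_at (linear_ext (\<lambda>m. if P m then mon (N m) else 0) f) r =
      (\<Sum>m\<in>Poly_Mapping.keys f. if P m \<and> N m = r then coeff_at f m else 0)"
    unfolding linear_ext_def lookup_sum
    by (intro sum.cong) (auto simp: mult_single lookup_single when_def)
  then show ?thesis
    by (simp add: sum.inter_filter)
qed

lemma weighted_degree_expo:
  "weighted_degree n (expo i j k l) = n 1 * i + n 2 * j + n 3 * k + n 4 * l"
  unfolding weighted_degree_def UNIV_4 by (simp add: lookup_expo[simplified])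

text \<open>The normalized situation. Equality of \<open>a\<^sub>1\<close> and
  \<open>a\<^sub>2\<close> means \<open>n 1 = n 2\<close>, when the critical exponent is 1; with
  \<open>u\<^sub>2 < a\<^sub>2\<close> this yields \<open>a\<^sub>2 < a\<^sub>1\<close> as soon as
  \<open>u\<^sub>2\<close> is positive.\<close>

locale reduced_curve = monomial_curve n "1 :: 4" K
  for n :: "4 \<Rightarrow> nat" and K :: "'k::field itself" +
  fixes a\<^sub>1 a\<^sub>2 a\<^sub>3 a\<^sub>4 u\<^sub>1 u\<^sub>2 u\<^sub>4 :: nat
  assumes gens: "(toric_ideal n :: (4, 'k) mpoly set) = Idl\<^bsub>mpoly_ring\<^esub>
      {mon (expo a\<^sub>1 0 0 0) - mon (expo 0 a\<^sub>2 0 0),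
       mon (expo 0 0 a\<^sub>3 0) - mon (expo 0 0 0 a\<^sub>4),
       mon (expo u\<^sub>1 u\<^sub>2 0 0) - mon (expo 0 0 0 u\<^sub>4)}"
    and a12: "0 < a\<^sub>2" "a\<^sub>2 \<le> a\<^sub>1" "a\<^sub>1 = a\<^sub>2 \<Longrightarrow> a\<^sub>2 = 1"
    and a34: "0 < a\<^sub>3" "a\<^sub>3 < a\<^sub>4"
    and u: "0 < u\<^sub>1" "u\<^sub>2 < a\<^sub>2" "0 < u\<^sub>4"
begin

text \<open>
  Reduction with respect to the leading monomials \<open>x\<^sub>3 ^ a\<^sub>3\<close>, \<open>x\<^sub>4 ^ u\<^sub>4\<close>, \<open>x\<^sub>2 ^ a\<^sub>2\<close>, in this order:
  no step makes a monomial reducible by an earlier one, so the normal form has a closed expression.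
\<close>

definition nf :: "nat \<Rightarrow> nat \<Rightarrow> nat \<Rightarrow> nat \<Rightarrow> (4 \<Rightarrow>\<^sub>0 nat)" where
  "nf i j k l =
     (let l' = l + a\<^sub>4 * (k div a\<^sub>3); q = l' div u\<^sub>4; j' = j + u\<^sub>2 * q
      in expo (i + u\<^sub>1 * q + a\<^sub>1 * (j' div a\<^sub>2)) (j' mod a\<^sub>2) (k mod a\<^sub>3) (l' mod u\<^sub>4))"

definition NF :: "(4 \<Rightarrow>\<^sub>0 nat) \<Rightarrow> (4 \<Rightarrow>\<^sub>0 nat)" where
  "NF m = nf (Poly_Mapping.lookup m 1) (Poly_Mapping.lookup m 2) (Poly_Mapping.lookup m 3) (Poly_Mapping.lookup m 4)"

lemma NF_expo: "NF (expo i j k l) = nf i j k l"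
  unfolding NF_def lookup_expo ..

lemma NF_step_3: "NF (expo i j (k + a\<^sub>3 * s) l) = NF (expo i j k (l + a\<^sub>4 * s))"
  using a34 by (simp add: NF_expo nf_def Let_def algebra_simps)

lemma NF_step_4: "NF (expo i j k (l + u\<^sub>4 * s)) = NF (expo (i + u\<^sub>1 * s) (j + u\<^sub>2 * s) k l)"
proof -
  have "(l + u\<^sub>4 * s + a\<^sub>4 * (k div a\<^sub>3)) = (l + a\<^sub>4 * (k div a\<^sub>3)) + u\<^sub>4 * s"
    by simp
  then show ?thesis
    using u unfolding NF_expo nf_def Let_def
    by (simp only: div_mult_self2 mod_mult_self2) (simp add: algebra_simps)
qed

lemma NF_step_2: "NF (expo i (j + a\<^sub>2 * s) k l) = NF (expo (i + a\<^sub>1 * s) j k l)"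
proof -
  have "j + a\<^sub>2 * s + x = (j + x) + a\<^sub>2 * s" for x
    by simp
  then show ?thesis
    using a12 unfolding NF_expo nf_def Let_def
    by (simp only: div_mult_self2 mod_mult_self2) (simp add: algebra_simps)
qed

text \<open>Each of the three groups of steps reducing \<open>m\<close> is also a legitimate group
  of steps on \<open>d + m\<close>. This replaces the check of S-polynomials.\<close>

lemma NF_add: "NF (d + NF m) = NF (d + m)"
proof -
  obtain i j k l where m: "m = expo i j k l" by (rule expo_cases)
  obtain i' j' k' l' where d: "d = expo i' j' k' l'" by (rule expo_cases)
  define s where "s = k div a\<^sub>3"
  define q where "q = (l + a\<^sub>4 * s) div u\<^sub>4"
  define w where "w = (j + u\<^sub>2 * q) div a\<^sub>2"
  have "NF (d + m) = NF (expo (i' + i) (j' + j) ((k' + k mod a\<^sub>3) + a\<^sub>3 * s) (l' + l))"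
    by (simp add: m d s_def add.assoc)
  also have "\<dots> = NF (expo (i' + i) (j' + j) (k' + k mod a\<^sub>3) ((l' + (l + a\<^sub>4 * s) mod u\<^sub>4) + u\<^sub>4 * q))"
    by (subst NF_step_3) (simp add: q_def add.assoc)
  also have "\<dots> = NF (expo (i' + i + u\<^sub>1 * q) ((j' + (j + u\<^sub>2 * q) mod a\<^sub>2) + a\<^sub>2 * w) (k' + k mod a\<^sub>3)
      (l' + (l + a\<^sub>4 * s) mod u\<^sub>4))"
    by (subst NF_step_4) (simp add: w_def add.assoc)
  also have "\<dots> = NF (expo (i' + i + u\<^sub>1 * q + a\<^sub>1 * w) (j' + (j + u\<^sub>2 * q) mod a\<^sub>2) (k' + k mod a\<^sub>3)
      (l' + (l + a\<^sub>4 * s) mod u\<^sub>4))"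
    by (subst NF_step_2) simp
  also have "\<dots> = NF (d + NF m)"
    by (simp add: m d NF_expo nf_def Let_def s_def q_def w_def add.assoc)
  finally show ?thesis ..
qed

lemma NF_linear_ext_toric:
  assumes "f \<in> toric_ideal n"
  shows "linear_ext (\<lambda>m. mon (NF m)) f = (0 :: (4, 'k) mpoly)"
proof -
  let ?ker = "{f. linear_ext (\<lambda>m. mon (NF m)) f = (0 :: (4, 'k) mpoly)}"
  have "ideal ?ker tring"
    by (rule ideal_linear_ext_kernel) (simp add: mult_single NF_add)
  moreover have "mon (expo a\<^sub>1 0 0 0) - mon (expo 0 a\<^sub>2 0 0) \<in> ?ker"
    using NF_step_2[of 0 0 1 0 0] by (simp add: linear_ext_diff)
  moreover have "mon (expo 0 0 a\<^sub>3 0) - mon (expo 0 0 0 a\<^sub>4) \<in> ?ker"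
    using NF_step_3[of 0 0 0 1 0] by (simp add: linear_ext_diff)
  moreover have "mon (expo u\<^sub>1 u\<^sub>2 0 0) - mon (expo 0 0 0 u\<^sub>4) \<in> ?ker"
    using NF_step_4[of 0 0 0 0 1] by (simp add: linear_ext_diff)
  ultimately have "toric_ideal n \<subseteq> ?ker"
    unfolding gens by (intro Idl_tring(3)) auto
  then show ?thesis
    using assms by auto
qed

text \<open>The toric ideal reduces to 0, so the coefficients of each of its members cancel along
  every fibre of \<open>NF\<close>.\<close>

lemma sum_fibre_NF:
  assumes "(f :: (4, 'k) mpoly) \<in> toric_ideal n"
  shows "(\<Sum>m\<in>{m \<in> Poly_Mapping.keys f. NF m = r}. coeff_at f m) = 0"
  using NF_linear_ext_toric[OF assms] lookup_linear_ext_mon[of "\<lambda>_. True" NF f r] by simp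

lemma generators_in_toric:
  "mon (expo a\<^sub>1 0 0 0) - mon (expo 0 a\<^sub>2 0 0) \<in> (toric_ideal n :: (4, 'k) mpoly set)"
  "mon (expo 0 0 a\<^sub>3 0) - mon (expo 0 0 0 a\<^sub>4) \<in> (toric_ideal n :: (4, 'k) mpoly set)"
  "mon (expo u\<^sub>1 u\<^sub>2 0 0) - mon (expo 0 0 0 u\<^sub>4) \<in> (toric_ideal n :: (4, 'k) mpoly set)"
  unfolding gens by (rule subsetD[OF Idl_tring(2)], simp)+

lemmas weight_generators = generators_in_toric[unfolded toric_ideal_binomial_iff]

text \<open>Such a monomial is alone in the highest degree of its fibre, whereas initial forms
  retain the lowest degree; so it occurs in no initial form.\<close>

definition dominant :: "(4 \<Rightarrow>\<^sub>0 nat) \<Rightarrow> bool" where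
  "dominant m \<longleftrightarrow> NF m = m \<and> (\<forall>m'. NF m' = m \<longrightarrow> m' = m \<or> total_degree m' < total_degree m)"

text \<open>If \<open>m\<close> occurred, the other members of its fibre would have degree too small
  to occur in \<open>f\<close>. The coefficient of \<open>m\<close> would then be a full fibre sum,
  which is 0.\<close>

lemma dominant_notin_initial_form:
  assumes f: "f \<in> toric_ideal n" and m: "dominant m"
  shows "m \<notin> Poly_Mapping.keys (initial_form f :: (4, 'k) mpoly)"
proof
  assume in_keys: "m \<in> Poly_Mapping.keys (initial_form f)"
  note D = keys_initial_formD[OF in_keys]
  have "{m' \<in> Poly_Mapping.keys f. NF m' = m} = {m}"
    using m D unfolding dominant_def by force
  then have "coeff_at f m = 0"
    using sum_fibre_NF[OF f, of m] by simp
  then show False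
    using D(1) by (simp add: in_keys_iff)
qed

text \<open>The polynomials in which no proper divisor of \<open>M\<close> occurs form an ideal; it
  contains all initial forms because those divisors are dominant.\<close>

lemma minimal_in_cone_support:
  assumes dom: "\<And>d m. M = d + m \<Longrightarrow> d \<noteq> 0 \<Longrightarrow> dominant m"
    and "p \<in> cone" "m \<in> Poly_Mapping.keys p" "M = d + m"
  shows "d = 0"
proof -
  let ?P = "{p :: (4, 'k) mpoly. \<forall>m\<in>Poly_Mapping.keys p. \<forall>d. M = d + m \<longrightarrow> d = 0}"
  have "cone \<subseteq> ?P"
  proof (rule cone_subsetI)
    show "ideal ?P tring"
    proof (rule ideal_tringI)
      show "x + y \<in> ?P" if "x \<in> ?P" "y \<in> ?P" for x y
        using that Poly_Mapping.keys_add[of x y] by blast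
      show "r * x \<in> ?P" if x: "x \<in> ?P" for r x
      proof safe
        fix m d assume "m \<in> Poly_Mapping.keys (r * x)" "M = d + m"
        then obtain a b where ab: "b \<in> Poly_Mapping.keys x" "M = (d + a) + b"
          using keys_mult[of r x] by (auto simp: add.assoc)
        have "d + a = 0"
          using x ab by blast
        then have "Poly_Mapping.lookup d v + Poly_Mapping.lookup a v = 0" for v
          by (metis lookup_add lookup_zero)
        then show "d = 0"
          by (intro poly_mapping_eqI) simp
      qed
    qed auto
    show "initial_form f \<in> ?P" if "f \<in> toric_ideal n" "f \<noteq> 0" for f
      using dominant_notin_initial_form[OF that(1)] dom by blast
  qed
  then show ?thesis
    using assms(2-4) by auto
qed

lemma proper_divisorE:
  assumes "expo i j k l = d + m" "d \<noteq> 0"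
  obtains i' j' k' l' where "m = expo i' j' k' l'" "i' \<le> i" "j' \<le> j" "k' \<le> k" "l' \<le> l"
    "i' < i \<or> j' < j \<or> k' < k \<or> l' < l"
proof -
  obtain i1 j1 k1 l1 where d: "d = expo i1 j1 k1 l1" by (rule expo_cases)
  obtain i' j' k' l' where m: "m = expo i' j' k' l'" by (rule expo_cases)
  show thesis
    using assms by (intro that[OF m]) (auto simp: d m)
qed

lemma dominantI:
  assumes "nf i j k l = expo i j k l"
    and "\<And>i' j' k' l'. nf i' j' k' l' = expo i j k l \<Longrightarrow>
      i' = i \<and> j' = j \<and> k' = k \<and> l' = l \<or> i' + j' + k' + l' < i + j + k + l"
  shows "dominant (expo i j k l)"
  unfolding dominant_def
proof (intro conjI allI impI)
  show "NF (expo i j k l) = expo i j k l"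
    by (simp add: NF_expo assms(1))
  fix m assume m: "NF m = expo i j k l"
  obtain i' j' k' l' where m': "m = expo i' j' k' l'" by (rule expo_cases)
  show "m = expo i j k l \<or> total_degree m < total_degree (expo i j k l)"
    using assms(2)[of i' j' k' l'] m by (simp add: m' NF_expo)
qed

text \<open>Here \<open>s\<close>, \<open>q\<close> and \<open>w\<close> count the reduction steps
  on the third, fourth and second variable.\<close>

lemma nf_fibreD:
  assumes "nf i j k l = expo i' j' k' l'"
  obtains s q w where "k = a\<^sub>3 * s + k'" "l + a\<^sub>4 * s = u\<^sub>4 * q + l'" "j + u\<^sub>2 * q = a\<^sub>2 * w + j'"
    "i + u\<^sub>1 * q + a\<^sub>1 * w = i'"
proof -
  define s where "s = k div a\<^sub>3"
  define q where "q = (l + a\<^sub>4 * s) div u\<^sub>4"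
  define w where "w = (j + u\<^sub>2 * q) div a\<^sub>2"
  have "i + u\<^sub>1 * q + a\<^sub>1 * w = i'" "(j + u\<^sub>2 * q) mod a\<^sub>2 = j'" "k mod a\<^sub>3 = k'" "(l + a\<^sub>4 * s) mod u\<^sub>4 = l'"
    using assms by (simp_all add: nf_def Let_def s_def q_def w_def)
  then show thesis
    by (intro that[of s q w]) (auto simp: s_def q_def w_def)
qed

section \<open>Dominant monomials and minimal monomials\<close>

lemma dominant_2:
  assumes "t < a\<^sub>2"
  shows "dominant (expo 0 t 0 0)"
proof (rule dominantI)
  show "nf 0 t 0 0 = expo 0 t 0 0"
    using assms by (simp add: nf_def Let_def)
  fix i j k l assume "nf i j k l = expo 0 t 0 0"
  then obtain s q w where *: "k = a\<^sub>3 * s + 0" "l + a\<^sub>4 * s = u\<^sub>4 * q + 0" "j + u\<^sub>2 * q = a\<^sub>2 * w + t"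
    "i + u\<^sub>1 * q + a\<^sub>1 * w = 0"
    by (rule nf_fibreD)
  \<comment> \<open>Steps on the fourth or second variable raise the exponent of the first, which is
    0 in the normal form.\<close>
  then have "q = 0" "w = 0"
    using u a12 by auto
  then show "i = 0 \<and> j = t \<and> k = 0 \<and> l = 0 \<or> i + j + k + l < 0 + t + 0 + 0"
    using * a34 by auto
qed

lemma dominant_3:
  assumes "t < a\<^sub>3"
  shows "dominant (expo 0 0 t 0)"
proof (rule dominantI)
  show "nf 0 0 t 0 = expo 0 0 t 0"
    using assms by (simp add: nf_def Let_def)
  fix i j k l assume "nf i j k l = expo 0 0 t 0"
  then obtain s q w where *: "k = a\<^sub>3 * s + t" "l + a\<^sub>4 * s = u\<^sub>4 * q + 0" "j + u\<^sub>2 * q = a\<^sub>2 * w + 0"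
    "i + u\<^sub>1 * q + a\<^sub>1 * w = 0"
    by (rule nf_fibreD)
  then have "q = 0" "w = 0"
    using u a12 by auto
  then show "i = 0 \<and> j = 0 \<and> k = t \<and> l = 0 \<or> i + j + k + l < 0 + 0 + t + 0"
    using * a34 by auto
qed

lemma dominant_4:
  assumes "t < u\<^sub>4"
  shows "dominant (expo 0 0 0 t)"
proof (rule dominantI)
  show "nf 0 0 0 t = expo 0 0 0 t"
    using assms by (simp add: nf_def Let_def)
  fix i j k l assume "nf i j k l = expo 0 0 0 t"
  then obtain s q w where *: "k = a\<^sub>3 * s + 0" "l + a\<^sub>4 * s = u\<^sub>4 * q + t" "j + u\<^sub>2 * q = a\<^sub>2 * w + 0"
    "i + u\<^sub>1 * q + a\<^sub>1 * w = 0"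
    by (rule nf_fibreD)
  then have "q = 0" "w = 0"
    using u a12 by auto
  \<comment> \<open>Only steps on the third variable remain, and each of them raises the
    degree.\<close>
  moreover have "s = 0 \<or> a\<^sub>3 * s < a\<^sub>4 * s"
    using a34 by auto
  ultimately show "i = 0 \<and> j = 0 \<and> k = 0 \<and> l = t \<or> i + j + k + l < 0 + 0 + 0 + t"
    using * by auto
qed

text \<open>A step on the fourth variable would bring in the factors \<open>u\<^sub>1\<close> and
  \<open>u\<^sub>2\<close> of the exponents, leaving \<open>y\<close> at least
  \<open>u\<^sub>2\<close> when \<open>x = u\<^sub>1\<close>; so \<open>q = 0\<close>. Steps on the
  second variable raise the degree strictly.\<close>

lemma dominant_12:
  assumes "a\<^sub>2 < a\<^sub>1" "y < a\<^sub>2" "x < u\<^sub>1 \<or> x = u\<^sub>1 \<and> y < u\<^sub>2"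
  shows "dominant (expo x y 0 0)"
proof (rule dominantI)
  show "nf x y 0 0 = expo x y 0 0"
    using assms by (simp add: nf_def Let_def)
  fix i j k l assume "nf i j k l = expo x y 0 0"
  then obtain s q w where *: "k = a\<^sub>3 * s + 0" "l + a\<^sub>4 * s = u\<^sub>4 * q + 0" "j + u\<^sub>2 * q = a\<^sub>2 * w + y"
    "i + u\<^sub>1 * q + a\<^sub>1 * w = x"
    by (rule nf_fibreD)
  have "q = 0"
  proof (rule ccontr)
    assume "q \<noteq> 0"
    then have le: "u\<^sub>1 \<le> u\<^sub>1 * q" "u\<^sub>2 \<le> u\<^sub>2 * q"
      by auto
    have "u\<^sub>1 \<le> x"
      using *(4) le(1) by linarith
    then have "x = u\<^sub>1" "y < u\<^sub>2"
      using assms(3) by auto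
    then have "a\<^sub>1 * w = 0"
      using *(4) le(1) by linarith
    then show False
      using *(3) le(2) \<open>y < u\<^sub>2\<close> a12 by auto
  qed
  moreover have "w = 0 \<or> a\<^sub>2 * w < a\<^sub>1 * w"
    using assms(1) by auto
  ultimately show "i = x \<and> j = y \<and> k = 0 \<and> l = 0 \<or> i + j + k + l < x + y + 0 + 0"
    using * a34 by auto
qed

lemma minimal_2:
  assumes "p \<in> cone" "m \<in> Poly_Mapping.keys p" "expo 0 a\<^sub>2 0 0 = d + m"
  shows "d = 0"
  by (rule minimal_in_cone_support[OF _ assms]) (auto intro: dominant_2 elim!: proper_divisorE)

lemma minimal_3:
  assumes "p \<in> cone" "m \<in> Poly_Mapping.keys p" "expo 0 0 a\<^sub>3 0 = d + m"
  shows "d = 0"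
  by (rule minimal_in_cone_support[OF _ assms]) (auto intro: dominant_3 elim!: proper_divisorE)

lemma minimal_4:
  assumes "p \<in> cone" "m \<in> Poly_Mapping.keys p" "expo 0 0 0 u\<^sub>4 = d + m"
  shows "d = 0"
  by (rule minimal_in_cone_support[OF _ assms]) (auto intro: dominant_4 elim!: proper_divisorE)

lemma minimal_12:
  assumes "a\<^sub>2 < a\<^sub>1" "p \<in> cone" "m \<in> Poly_Mapping.keys p" "expo u\<^sub>1 u\<^sub>2 0 0 = d + m"
  shows "d = 0"
proof (rule minimal_in_cone_support[OF _ assms(2-4)])
  fix d m assume "expo u\<^sub>1 u\<^sub>2 0 0 = d + m" "d \<noteq> 0"
  then obtain i j where "m = expo i j 0 0" "i \<le> u\<^sub>1" "j \<le> u\<^sub>2" "i < u\<^sub>1 \<or> j < u\<^sub>2"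
    by (elim proper_divisorE) auto
  then show "dominant m"
    using u(2) assms(1) by (auto intro!: dominant_12)
qed

end

section \<open>The tangent cone in the two cases\<close>

lemma mon_mult_expo [simp]:
  "(mon (expo i j k l) :: (4, 'k::field) mpoly) * mon (expo i' j' k' l') = mon (expo (i + i') (j + j') (k + k') (l + l'))"
  by (simp add: mult_single)

lemma total_degree_eq_0D: "total_degree d = 0 \<Longrightarrow> d = 0"
  by (rule poly_mapping_eqI) (simp add: total_degree_def)

lemma lookup_mon: "coeff_at (mon m :: ('v, 'k::field) mpoly) m' = (if m' = m then 1 else 0)"
  by (auto simp: lookup_single)

lemma single_mem_ideal:
  assumes "ideal I tring" "mon m \<in> I"
  shows "Poly_Mapping.single m c \<in> (I :: ('v, 'k::field) mpoly set)"
  using ideal_tringD(3)[OF assms, of "Poly_Mapping.single 0 c"] by (simp add: mult_single)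

text \<open>The terms of \<open>p\<close> at \<open>A\<close> lie in \<open>J\<close> and can be
  subtracted; afterwards the coefficient at \<open>x\<close> is scaled to 1.\<close>

lemma ideal_dual_element:
  fixes J :: "('v, 'k::field) mpoly set"
  assumes J: "ideal J tring" and "finite A" and A: "mon ` A \<subseteq> J"
    and p: "p \<in> J" "x \<in> Poly_Mapping.keys p" and "x \<notin> A"
  shows "\<exists>e\<in>J. \<forall>y\<in>insert x A. coeff_at e y = (if y = x then 1 else 0)"
proof -
  define e where "e = Poly_Mapping.single 0 (inverse (coeff_at p x)) *
    (p - (\<Sum>m\<in>A. Poly_Mapping.single m (coeff_at p m)))"
  have "Poly_Mapping.single m (coeff_at p m) \<in> J" if "m \<in> A" for m
    by (rule single_mem_ideal[OF J]) (use A that in blast)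
  then have "e \<in> J"
    unfolding e_def by (intro ideal_tringD(3,6)[OF J] ideal_tring_sum[OF J] p)
  moreover have "coeff_at (\<Sum>m\<in>A. Poly_Mapping.single m (coeff_at p m)) y = (if y \<in> A then coeff_at p y else 0)" for y
    using \<open>finite A\<close> by (simp add: lookup_sum lookup_single when_def)
  then have "coeff_at e y = (if y = x then 1 else 0)" if "y \<in> insert x A" for y
    using that p(2) \<open>x \<notin> A\<close> by (auto simp: e_def lookup_const_mult lookup_minus in_keys_iff)
  ultimately show ?thesis
    by blast
qed

context reduced_curve
begin

lemma weight_relations:
  "n 1 * a\<^sub>1 = n 2 * a\<^sub>2" "n 3 * a\<^sub>3 = n 4 * a\<^sub>4" "n 1 * u\<^sub>1 + n 2 * u\<^sub>2 = n 4 * u\<^sub>4"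
  using weight_generators unfolding weighted_degree_expo by (simp_all del: One_nat_def)

lemma axis_expo: "axis k = expo k 0 0 0"
  by (simp add: axis_def expo_def)

lemma mon_3_in_cone: "mon (expo 0 0 a\<^sub>3 0) \<in> cone"
  using weight_generators(2) a34 by (intro cone_binomial_less[of _ "expo 0 0 0 a\<^sub>4"]) auto

subsection \<open>The non-Cohen--Macaulay case\<close>

context
  assumes lt: "u\<^sub>1 + u\<^sub>2 < u\<^sub>4"
begin

text \<open>Otherwise \<open>n 1 * u\<^sub>1 = n 4 * u\<^sub>4\<close>, contradicting
  \<open>n 1 \<le> n 4\<close> and \<open>u\<^sub>1 < u\<^sub>4\<close>.\<close>

lemma u2_pos: "0 < u\<^sub>2"
proof (rule ccontr)
  assume "\<not> 0 < u\<^sub>2"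
  then have "n 1 * u\<^sub>1 = n 4 * u\<^sub>4" "u\<^sub>1 < u\<^sub>4"
    using weight_relations(3) lt by auto
  moreover have "n 1 * u\<^sub>1 < n 1 * u\<^sub>4" "n 1 * u\<^sub>4 \<le> n 4 * u\<^sub>4"
    using \<open>u\<^sub>1 < u\<^sub>4\<close> pos[of 1] least[of 4] by (simp_all del: One_nat_def)
  ultimately show False
    by linarith
qed

lemma a21_less: "a\<^sub>2 < a\<^sub>1"
  using a12 u2_pos u(2) by (cases "a\<^sub>1 = a\<^sub>2") auto

lemma mon_12_in_cone: "mon (expo u\<^sub>1 u\<^sub>2 0 0) \<in> cone"
  using weight_generators(3) lt by (intro cone_binomial_less[of _ "expo 0 0 0 u\<^sub>4"]) auto

lemma mon_2_in_cone: "mon (expo 0 a\<^sub>2 0 0) \<in> cone"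
  using weight_generators(1) a21_less by (intro cone_binomial_less[of _ "expo a\<^sub>1 0 0 0"]) auto

lemma not_cohen_macaulay: "\<not> cohen_macaulay_tangent_cone K n"
proof (rule not_cohen_macaulay_cone)
  show "mon (expo 0 u\<^sub>2 0 0) \<notin> cone"
    using minimal_2[of "mon (expo 0 u\<^sub>2 0 0)" "expo 0 u\<^sub>2 0 0" "expo 0 (a\<^sub>2 - u\<^sub>2) 0 0"] u(2) by auto
  show "mon (axis u\<^sub>1) * mon (expo 0 u\<^sub>2 0 0) \<in> cone"
    using mon_12_in_cone by (simp add: axis_expo)
qed

text \<open>Multiplying the third binomial by the power \<open>a\<^sub>2 - u\<^sub>2\<close> of the
  second variable and reducing with the first binomial shows that the two monomials have equal
  weight. Whichever has the smaller degree lies in \<open>cone\<close>; if the degrees agree, their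
  difference does.\<close>

lemma fourth_monomial:
  "\<exists>p\<in>cone. \<exists>m\<in>Poly_Mapping.keys p. m = expo (u\<^sub>1 + a\<^sub>1) 0 0 0 \<or> m = expo 0 (a\<^sub>2 - u\<^sub>2) 0 u\<^sub>4"
proof -
  let ?a = "expo (u\<^sub>1 + a\<^sub>1) 0 0 0" and ?b = "expo 0 (a\<^sub>2 - u\<^sub>2) 0 u\<^sub>4"
  have "n 2 * a\<^sub>2 = n 2 * (a\<^sub>2 - u\<^sub>2) + n 2 * u\<^sub>2"
    using u(2) by (simp flip: distrib_left)
  then have w: "weight ?a = weight ?b"
    using weight_relations(1,3) unfolding weighted_degree_expo by (simp add: distrib_left del: One_nat_def)
  consider "total_degree ?a < total_degree ?b" | "total_degree ?b < total_degree ?a"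
    | "total_degree ?a = total_degree ?b"
    by linarith
  then show ?thesis
  proof cases
    case 1
    then show ?thesis
      using cone_binomial_less[OF w] by (intro bexI[of _ "mon ?a"]) auto
  next
    case 2
    then show ?thesis
      using cone_binomial_less[OF w[symmetric]] by (intro bexI[of _ "mon ?b"]) auto
  next
    case 3
    have "?a \<in> Poly_Mapping.keys (mon ?a - mon ?b :: (4, 'k) mpoly)"
      using u(3) by (auto simp: in_keys_iff lookup_minus lookup_mon)
    then show ?thesis
      using cone_binomial_eq[OF w 3] by blast
  qed
qed

lemma four_generators:
  assumes S: "finite S" "Idl\<^bsub>mpoly_ring\<^esub> S = cone"
  shows "4 \<le> card S"
proof -
  let ?M1 = "expo 0 a\<^sub>2 0 0" and ?M2 = "expo 0 0 a\<^sub>3 0" and ?M3 = "expo u\<^sub>1 u\<^sub>2 0 0"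
  \<comment> \<open>The monomials occurring in \<open>cone\<close> but divisible by none of the
    three known minimal ones.\<close>
  define Y where "Y = {m. (\<exists>p\<in>cone. m \<in> Poly_Mapping.keys p) \<and>
    (\<forall>d. m \<noteq> d + ?M1) \<and> (\<forall>d. m \<noteq> d + ?M2) \<and> (\<forall>d. m \<noteq> d + ?M3)}"
  obtain p m where pm: "p \<in> cone" "m \<in> Poly_Mapping.keys p"
    "m = expo (u\<^sub>1 + a\<^sub>1) 0 0 0 \<or> m = expo 0 (a\<^sub>2 - u\<^sub>2) 0 u\<^sub>4"
    using fourth_monomial by blast
  have "m \<noteq> d + ?M1 \<and> m \<noteq> d + ?M2 \<and> m \<noteq> d + ?M3" for d
  proof -
    obtain i j k l where d: "d = expo i j k l" by (rule expo_cases)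
    show ?thesis
      using pm(3) a12 a34 u u2_pos by (auto simp: d)
  qed
  then have "m \<in> Y"
    using pm(1,2) by (auto simp: Y_def)
  \<comment> \<open>Least degree suffices for minimality: a divisor of \<open>M4\<close> occurring
    in \<open>cone\<close> is again in \<open>Y\<close>.\<close>
  define M4 where "M4 = (ARG_MIN total_degree m. m \<in> Y)"
  have M4: "M4 \<in> Y" "\<And>m. m \<in> Y \<Longrightarrow> total_degree M4 \<le> total_degree m"
    using arg_min_natI[of "\<lambda>m. m \<in> Y" m total_degree] arg_min_nat_le[of "\<lambda>m. m \<in> Y" _ total_degree] \<open>m \<in> Y\<close>
    by (auto simp: M4_def)
  have M4_nd: "M4 \<noteq> d + ?M1" "M4 \<noteq> d + ?M2" "M4 \<noteq> d + ?M3" for d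
    using M4(1) unfolding Y_def by blast+
  have ne: "M4 \<noteq> ?M1" "M4 \<noteq> ?M2" "M4 \<noteq> ?M3"
    using M4_nd[of 0] by simp_all
  let ?B = "{?M1, ?M2, ?M3, M4}"
  have "card ?B \<le> card S"
  proof (rule card_generators_ge)
    fix M p m d
    assume M: "M \<in> ?B" and p: "p \<in> Idl\<^bsub>mpoly_ring\<^esub> S" "m \<in> Poly_Mapping.keys p" and dm: "M = d + m"
    have p': "p \<in> cone"
      using p(1) S(2) by simp
    consider "M = ?M1" | "M = ?M2" | "M = ?M3" | "M = M4"
      using M by auto
    then show "d = 0"
    proof cases
      case 1
      then show ?thesis
        using minimal_2[OF p' p(2)] dm by simp
    next
      case 2
      then show ?thesis
        using minimal_3[OF p' p(2)] dm by simp
    next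
      case 3
      then show ?thesis
        using minimal_12[OF a21_less p' p(2)] dm by simp
    next
      case 4
      have "m \<in> Y"
        unfolding Y_def
      proof (intro CollectI conjI allI notI)
        show "\<exists>p\<in>cone. m \<in> Poly_Mapping.keys p"
          using p' p(2) by blast
      next
        fix d' assume "m = d' + ?M1"
        then show False
          using M4_nd(1)[of "d + d'"] dm 4 by (simp add: add.assoc)
      next
        fix d' assume "m = d' + ?M2"
        then show False
          using M4_nd(2)[of "d + d'"] dm 4 by (simp add: add.assoc)
      next
        fix d' assume "m = d' + ?M3"
        then show False
          using M4_nd(3)[of "d + d'"] dm 4 by (simp add: add.assoc)
      qed
      then have "total_degree d = 0"
        using M4(2)[of m] dm 4 by (simp add: total_degree_add)
      then show ?thesis
        by (rule total_degree_eq_0D)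
    qed
  next
    note in_cone = mon_2_in_cone mon_3_in_cone mon_12_in_cone
    have B_ne: "?M1 \<noteq> ?M2" "?M1 \<noteq> ?M3" "?M2 \<noteq> ?M3"
      using a12 a34 u by auto
    fix M assume "M \<in> ?B"
    then consider "M \<in> {?M1, ?M2, ?M3}" | "M = M4"
      by auto
    then show "\<exists>e\<in>Idl\<^bsub>mpoly_ring\<^esub> S. \<forall>M'\<in>?B. coeff_at e M' = (if M' = M then 1 else 0)"
    proof cases
      case 1
      then have "(mon M :: (4, 'k) mpoly) \<in> Idl\<^bsub>mpoly_ring\<^esub> S"
        unfolding S(2) using in_cone by auto
      then show ?thesis
        by (rule bexI[rotated]) (simp add: lookup_mon)
    next
      case 2
      obtain p where p: "p \<in> cone" "M4 \<in> Poly_Mapping.keys p"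
        using M4(1)[unfolded Y_def mem_Collect_eq, THEN conjunct1] by (elim bexE)
      \<comment> \<open>\<open>M4\<close> itself need not lie in \<open>cone\<close>, so its dual
        element is a polynomial containing it, cleared of the other three monomials.\<close>
      have "\<exists>e\<in>cone. \<forall>M'\<in>insert M4 {?M1, ?M2, ?M3}. coeff_at e M' = (if M' = M4 then 1 else 0)"
        by (rule ideal_dual_element[OF ideal_cone _ _ p]) (simp_all add: in_cone ne)
      moreover have "?B = insert M4 {?M1, ?M2, ?M3}"
        by (simp only: insert_commute)
      ultimately show ?thesis
        unfolding S(2) 2 by (simp only:)
    qed
  qed (use S in auto)
  moreover have "card ?B = 4"
    using ne ne[symmetric] a12 a34 u by (subst card_insert_disjoint; auto)+
  ultimately show ?thesis
    by simp
qed

lemma not_complete_intersection: "\<not> complete_intersection_tangent_cone K n"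
proof -
  have "4 \<le> min_num_generators mpoly_ring cone"
    unfolding min_num_generators_def
    by (rule INF_greatest) (use four_generators in \<open>auto simp: numeral_eq_enat\<close>)
  moreover have "\<not> (4 :: enat) \<le> 3"
    by (simp add: numeral_eq_enat)
  ultimately show ?thesis
    unfolding complete_intersection_tangent_cone_def by metis
qed

end

subsection \<open>The complete intersection case\<close>

context
  assumes ge: "u\<^sub>4 \<le> u\<^sub>1 + u\<^sub>2"
begin

text \<open>Each kind of step does not lower the degree, by \<open>a\<^sub>3 < a\<^sub>4\<close>,
  \<open>u\<^sub>4 \<le> u\<^sub>1 + u\<^sub>2\<close> and \<open>a\<^sub>2 \<le> a\<^sub>1\<close>
  respectively.\<close>

lemma total_degree_NF: "total_degree m \<le> total_degree (NF m)"
proof -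
  obtain i j k l where m: "m = expo i j k l" by (rule expo_cases)
  obtain i' j' k' l' where nf: "nf i j k l = expo i' j' k' l'" by (rule expo_cases)
  obtain s q w where *: "k = a\<^sub>3 * s + k'" "l + a\<^sub>4 * s = u\<^sub>4 * q + l'" "j + u\<^sub>2 * q = a\<^sub>2 * w + j'"
    "i + u\<^sub>1 * q + a\<^sub>1 * w = i'"
    by (rule nf_fibreD[OF nf])
  have "a\<^sub>3 * s \<le> a\<^sub>4 * s" "u\<^sub>4 * q \<le> u\<^sub>1 * q + u\<^sub>2 * q" "a\<^sub>2 * w \<le> a\<^sub>1 * w"
    using a34 a12 ge by (simp_all flip: distrib_right)
  then show ?thesis
    unfolding m NF_expo nf total_degree_expo using * by linarith
qed

text \<open>The graded shadow of \<open>NF\<close>: reductions that raise the degree have a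
  vanishing contribution in the tangent cone. Its kernel turns out to be
  \<open>cone\<close>.\<close>

definition \<psi> :: "(4 \<Rightarrow>\<^sub>0 nat) \<Rightarrow> (4, 'k) mpoly" where
  "\<psi> m = (if total_degree (NF m) = total_degree m then mon (NF m) else 0)"

text \<open>The rise in degree from \<open>d + m\<close> to its normal form is the sum of the rises
  in reducing \<open>m\<close> and then \<open>d + NF m\<close>. Both are nonnegative, so the total
  vanishes only if both do.\<close>

lemma ideal_kernel_psi: "ideal {p. linear_ext \<psi> p = 0} tring"
proof (rule ideal_linear_ext_kernel)
  fix d m
  show "\<psi> (d + m) = linear_ext \<psi> (mon d * \<psi> m)"
    using total_degree_NF[of m] total_degree_NF[of "d + NF m"]
    by (auto simp: \<psi>_def mult_single NF_add total_degree_add)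
qed

lemma cone_subset_kernel_psi: "cone \<subseteq> {p. linear_ext \<psi> p = 0}"
proof (rule cone_subsetI[OF ideal_kernel_psi])
  fix f :: "(4, 'k) mpoly" assume f: "f \<in> toric_ideal n" "f \<noteq> 0"
  define d where "d = Min (total_degree ` Poly_Mapping.keys f)"
  have d: "d \<le> total_degree m" if "m \<in> Poly_Mapping.keys f" for m
    unfolding d_def using that by (intro Min_le) auto
  have "coeff_at (linear_ext \<psi> (initial_form f)) r = 0" for r
  proof -
    \<comment> \<open>If \<open>r\<close> has the least degree \<open>d\<close> of \<open>f\<close>,
      every monomial of \<open>f\<close> with normal form \<open>r\<close> has degree exactly
      \<open>d\<close>, so \<open>?A\<close> is a full fibre. For other degrees \<open>?A\<close> is
      empty.\<close>
    let ?A = "{m \<in> Poly_Mapping.keys (initial_form f). total_degree (NF m) = total_degree m \<and> NF m = r}"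
    have "coeff_at (linear_ext \<psi> (initial_form f)) r = (\<Sum>m\<in>?A. coeff_at (initial_form f) m)"
      unfolding \<psi>_def[abs_def] by (rule lookup_linear_ext_mon)
    also have "\<dots> = 0"
    proof (cases "total_degree r = d")
      case True
      have "?A = {m \<in> Poly_Mapping.keys f. NF m = r}"
        using True d total_degree_NF
        by (auto simp: in_keys_iff lookup_initial_form simp flip: d_def intro: antisym split: if_splits)
      moreover have "coeff_at (initial_form f) m = coeff_at f m" if "m \<in> ?A" for m
        using that by (auto simp: in_keys_iff lookup_initial_form split: if_splits)
      ultimately show ?thesis
        using sum_fibre_NF[OF f(1), of r] by simp
    next
      case False
      then have "?A = {}"
        by (auto simp: in_keys_iff lookup_initial_form simp flip: d_def split: if_splits)
      then show ?thesis
        by (simp only: sum.empty)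
    qed
    finally show ?thesis .
  qed
  then show "initial_form f \<in> {p. linear_ext \<psi> p = 0}"
    by (auto intro: poly_mapping_eqI)
qed

text \<open>These three are, up to sign, the initial forms of the generators; the case distinctions
  record whether a binomial is homogeneous.\<close>

definition g\<^sub>1 :: "(4, 'k) mpoly" where
  "g\<^sub>1 = mon (expo 0 a\<^sub>2 0 0) - (if a\<^sub>1 = a\<^sub>2 then mon (expo a\<^sub>1 0 0 0) else 0)"

definition g\<^sub>2 :: "(4, 'k) mpoly" where
  "g\<^sub>2 = mon (expo 0 0 a\<^sub>3 0)"

definition g\<^sub>3 :: "(4, 'k) mpoly" where
  "g\<^sub>3 = mon (expo 0 0 0 u\<^sub>4) - (if u\<^sub>1 + u\<^sub>2 = u\<^sub>4 then mon (expo u\<^sub>1 u\<^sub>2 0 0) else 0)"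

lemma g_in_cone: "{g\<^sub>1, g\<^sub>2, g\<^sub>3} \<subseteq> cone"
proof -
  have "g\<^sub>1 \<in> cone"
  proof (cases "a\<^sub>1 = a\<^sub>2")
    case True
    have "mon (expo 0 a\<^sub>2 0 0) - mon (expo a\<^sub>1 0 0 0) \<in> cone"
      by (rule cone_binomial_eq[OF weight_generators(1)[symmetric]]) (simp add: True)
    then show ?thesis
      unfolding g\<^sub>1_def using True by simp
  next
    case False
    then have "mon (expo 0 a\<^sub>2 0 0) \<in> cone"
      using a12 by (intro cone_binomial_less[OF weight_generators(1)[symmetric]]) simp
    then show ?thesis
      unfolding g\<^sub>1_def using False by simp
  qed
  moreover have "g\<^sub>3 \<in> cone"
  proof (cases "u\<^sub>1 + u\<^sub>2 = u\<^sub>4")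
    case True
    have "mon (expo 0 0 0 u\<^sub>4) - mon (expo u\<^sub>1 u\<^sub>2 0 0) \<in> cone"
      by (rule cone_binomial_eq[OF weight_generators(3)[symmetric]]) (simp add: True)
    then show ?thesis
      unfolding g\<^sub>3_def using True by simp
  next
    case False
    then have "mon (expo 0 0 0 u\<^sub>4) \<in> cone"
      using ge by (intro cone_binomial_less[OF weight_generators(3)[symmetric]]) simp
    then show ?thesis
      unfolding g\<^sub>3_def using False by simp
  qed
  ultimately show ?thesis
    using mon_3_in_cone by (simp add: g\<^sub>2_def)
qed

text \<open>One reduction step from \<open>m\<close> to \<open>m'\<close>. If the degree rises,
  \<open>\<psi> m = 0\<close> and \<open>m\<close> itself must lie in \<open>I\<close>; otherwise
  both have the same image and only their difference matters.\<close>

lemma psi_step: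
  assumes I: "ideal I tring"
    and NF: "NF m' = NF m"
    and le: "total_degree m \<le> total_degree m'"
    and less: "total_degree m < total_degree m' \<Longrightarrow> mon m \<in> I"
    and eq: "total_degree m = total_degree m' \<Longrightarrow> mon m - mon m' \<in> I"
    and m': "mon m' - \<psi> m' \<in> I"
  shows "mon m - \<psi> m \<in> I"
proof (cases "total_degree m < total_degree m'")
  case True
  then have "\<psi> m = 0"
    using total_degree_NF[of m'] NF by (simp add: \<psi>_def)
  then show ?thesis
    using less True by simp
next
  case False
  then have deg: "total_degree m = total_degree m'"
    using le by simp
  then have "\<psi> m = \<psi> m'"
    using NF by (simp add: \<psi>_def)
  then show ?thesis
    using ideal_tringD(2)[OF I eq[OF deg] m'] by simp
qed

lemma mon_minus_psi:
  "mon m - \<psi> m \<in> Idl\<^bsub>mpoly_ring\<^esub> {g\<^sub>1, g\<^sub>2, g\<^sub>3}"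
proof -
  define I where "I = Idl\<^bsub>mpoly_ring\<^esub> {g\<^sub>1, g\<^sub>2, g\<^sub>3}"
  have I: "ideal I tring"
    unfolding I_def by (rule Idl_tring)
  have g: "p * g\<^sub>1 \<in> I" "p * g\<^sub>2 \<in> I" "p * g\<^sub>3 \<in> I" for p
    unfolding I_def by (rule ideal_tringD(3)[OF Idl_tring(1) subsetD[OF Idl_tring(2)]], simp)+
  have "mon (expo i j k l) * g\<^sub>1 =
      mon (expo i (j + a\<^sub>2) k l) - (if a\<^sub>1 = a\<^sub>2 then mon (expo (i + a\<^sub>1) j k l) else 0)" for i j k l
    unfolding g\<^sub>1_def by (simp add: right_diff_distrib)
  then have gm1: "mon (expo i (j + a\<^sub>2) k l) - (if a\<^sub>1 = a\<^sub>2 then mon (expo (i + a\<^sub>1) j k l) else 0) \<in> I" for i j k l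
    using g(1)[of "mon (expo i j k l)"] by (simp only:)
  have "mon (expo i j k l) * g\<^sub>3 =
      mon (expo i j k (l + u\<^sub>4)) - (if u\<^sub>1 + u\<^sub>2 = u\<^sub>4 then mon (expo (i + u\<^sub>1) (j + u\<^sub>2) k l) else 0)" for i j k l
    unfolding g\<^sub>3_def by (simp add: right_diff_distrib)
  then have gm3: "mon (expo i j k (l + u\<^sub>4)) -
      (if u\<^sub>1 + u\<^sub>2 = u\<^sub>4 then mon (expo (i + u\<^sub>1) (j + u\<^sub>2) k l) else 0) \<in> I" for i j k l
    using g(3)[of "mon (expo i j k l)"] by (simp only:)
  \<comment> \<open>The inductions run opposite to the order of reduction: each one assumes the
    exponents treated earlier to be already reduced.\<close>
  have step2: "mon (expo i j k l) - \<psi> (expo i j k l) \<in> I" if kl: "k < a\<^sub>3" "l < u\<^sub>4" for i j k l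
  proof (induction j arbitrary: i rule: less_induct)
    case (less j)
    show ?case
    proof (cases "j < a\<^sub>2")
      case True
      then have "\<psi> (expo i j k l) = mon (expo i j k l)"
        using kl by (simp add: \<psi>_def NF_expo nf_def Let_def)
      then show ?thesis
        using ideal_tringD(1)[OF I] by simp
    next
      case False
      then obtain j' where j: "j = j' + a\<^sub>2"
        by (metis le_add_diff_inverse2 not_less)
      show ?thesis
      proof (rule psi_step[OF I, of "expo (i + a\<^sub>1) j' k l"])
        show "NF (expo (i + a\<^sub>1) j' k l) = NF (expo i j k l)"
          using NF_step_2[of i j' 1 k l] by (simp add: j)
        show "mon (expo (i + a\<^sub>1) j' k l) - \<psi> (expo (i + a\<^sub>1) j' k l) \<in> I"
          using a12 by (intro less) (simp add: j)
      qed (use gm1[of i j' k l] a12 in \<open>auto simp: j split: if_splits\<close>)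
    qed
  qed
  have step4: "mon (expo i j k l) - \<psi> (expo i j k l) \<in> I" if k: "k < a\<^sub>3" for i j k l
  proof (induction l arbitrary: i j rule: less_induct)
    case (less l)
    show ?case
    proof (cases "l < u\<^sub>4")
      case False
      then obtain l' where l: "l = l' + u\<^sub>4"
        by (metis le_add_diff_inverse2 not_less)
      show ?thesis
      proof (rule psi_step[OF I, of "expo (i + u\<^sub>1) (j + u\<^sub>2) k l'"])
        show "NF (expo (i + u\<^sub>1) (j + u\<^sub>2) k l') = NF (expo i j k l)"
          using NF_step_4[of i j k l' 1] by (simp add: l)
        show "mon (expo (i + u\<^sub>1) (j + u\<^sub>2) k l') - \<psi> (expo (i + u\<^sub>1) (j + u\<^sub>2) k l') \<in> I"
          using u by (intro less) (simp add: l)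
      qed (use gm3[of i j k l'] ge in \<open>auto simp: l split: if_splits\<close>)
    qed (intro step2 k)
  qed
  obtain i j k l where m: "m = expo i j k l" by (rule expo_cases)
  have "mon m - \<psi> m \<in> I"
  proof (cases "k < a\<^sub>3")
    case False
    then obtain k' where k: "k = k' + a\<^sub>3"
      by (metis le_add_diff_inverse2 not_less)
    \<comment> \<open>A step on the third variable always raises the degree, so \<open>m\<close> is
      sent to 0 and is a multiple of \<open>g\<^sub>2\<close>.\<close>
    have "total_degree (expo i j k l) < total_degree (expo i j k' (l + a\<^sub>4))"
      using a34 by (simp add: k)
    also have "\<dots> \<le> total_degree (NF (expo i j k l))"
      using total_degree_NF[of "expo i j k' (l + a\<^sub>4)"] NF_step_3[of i j k' 1 l] by (simp add: k)
    finally have "\<psi> m = 0"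
      by (simp add: \<psi>_def m)
    moreover have "mon m \<in> I"
      using g(2)[of "mon (expo i j k' l)"] by (simp add: g\<^sub>2_def m k)
    ultimately show ?thesis
      by simp
  qed (simp only: m step4)
  then show ?thesis
    by (simp only: I_def)
qed

lemma kernel_psi_subset: "{p. linear_ext \<psi> p = 0} \<subseteq> Idl\<^bsub>mpoly_ring\<^esub> {g\<^sub>1, g\<^sub>2, g\<^sub>3}"
proof
  fix p assume "p \<in> {p. linear_ext \<psi> p = 0}"
  then show "p \<in> Idl\<^bsub>mpoly_ring\<^esub> {g\<^sub>1, g\<^sub>2, g\<^sub>3}"
    using diff_linear_ext_mem[OF Idl_tring(1) mon_minus_psi, of p] by simp
qed

text \<open>The inclusions from \<open>cone\<close> to the kernel, to the ideal of the initial forms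
  and back to \<open>cone\<close> close a circle.\<close>

lemma cone_eq_Idl: "cone = Idl\<^bsub>mpoly_ring\<^esub> {g\<^sub>1, g\<^sub>2, g\<^sub>3}"
  and cone_eq_kernel: "cone = {p. linear_ext \<psi> p = 0}"
  using cone_subset_kernel_psi kernel_psi_subset Idl_tring(3)[OF ideal_cone g_in_cone] by blast+

text \<open>The first variable divides none of the leading monomials, so multiplication by it
  commutes with reduction.\<close>

lemma linear_ext_psi_axis: "linear_ext \<psi> (mon (axis k) * p) = mon (axis k) * linear_ext \<psi> p"
proof (induction p rule: mpoly_induct)
  case (single m c)
  have NF: "NF (axis k + m) = axis k + NF m"
  proof -
    obtain i j k' l where m: "m = expo i j k' l" by (rule expo_cases)
    show ?thesis
      by (simp add: axis_expo m NF_expo nf_def Let_def add.assoc)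
  qed
  then have "\<psi> (axis k + m) = mon (axis k) * \<psi> m"
    by (simp add: \<psi>_def total_degree_add mult_single)
  then show ?case
    by (simp add: mult_single linear_ext_single mult.left_commute)
qed (simp add: linear_ext_add distrib_left)

lemma linear_ext_psi_line: "linear_ext \<psi> (line r * p) = line r * linear_ext \<psi> p"
proof -
  have sum: "linear_ext \<psi> (sum h A) = (\<Sum>i\<in>A. linear_ext \<psi> (h i))" for h and A :: "nat set"
    by (induction A rule: infinite_finite_induct) (auto simp: linear_ext_add)
  have single: "Poly_Mapping.single (axis i) c = Poly_Mapping.single 0 c * mon (axis i)" for i and c :: 'k
    by (simp add: mult_single)
  have "linear_ext \<psi> (Poly_Mapping.single (axis i) c * p) = Poly_Mapping.single (axis i) c * linear_ext \<psi> p" for i c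
    using linear_ext_const_mult[of \<psi> c "mon (axis i) * p"]
    by (simp only: single[of i c] mult.assoc linear_ext_psi_axis)
  then show ?thesis
    by (simp add: line_def sum_distrib_right sum)
qed

text \<open>The quotient embeds through \<open>\<psi>\<close> into the polynomial ring, linearly
  over the polynomials in the first variable, so it is torsion-free.\<close>

lemma cohen_macaulay: "cohen_macaulay_tangent_cone K n"
proof (rule cohen_macaulay_cone)
  fix r z assume "r \<noteq> 0" and "line r * z \<in> cone"
  then have "line r * linear_ext \<psi> z = 0"
    by (simp add: cone_eq_kernel linear_ext_psi_line)
  moreover have "line r \<noteq> 0"
    using to_line_line[of r] to_line_0 \<open>r \<noteq> 0\<close> by metis
  ultimately show "z \<in> cone"
    by (simp add: cone_eq_kernel)
qed

text \<open>The leading monomials are minimal in the support of \<open>cone\<close>, and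
  \<open>g\<^sub>1\<close>, \<open>g\<^sub>2\<close>, \<open>g\<^sub>3\<close> are dual to
  them.\<close>

lemma three_generators:
  assumes S: "finite S" "Idl\<^bsub>mpoly_ring\<^esub> S = cone"
  shows "3 \<le> card S"
proof -
  let ?M1 = "expo 0 a\<^sub>2 0 0" and ?M2 = "expo 0 0 a\<^sub>3 0" and ?M3 = "expo 0 0 0 u\<^sub>4"
  let ?B = "{?M1, ?M2, ?M3}"
  have "card ?B \<le> card S"
  proof (rule card_generators_ge)
    fix M p m d
    assume "M \<in> ?B" and p: "p \<in> Idl\<^bsub>mpoly_ring\<^esub> S" "m \<in> Poly_Mapping.keys p" and "M = d + m"
    then show "d = 0"
      using minimal_2[of p m d] minimal_3[of p m d] minimal_4[of p m d] S(2) by auto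
  next
    fix M assume "M \<in> ?B"
    then consider "M = ?M1" | "M = ?M2" | "M = ?M3"
      by auto
    then show "\<exists>e\<in>Idl\<^bsub>mpoly_ring\<^esub> S. \<forall>M'\<in>?B. coeff_at e M' = (if M' = M then 1 else 0)"
    proof cases
      case 1
      then show ?thesis
        using g_in_cone a12 a34 u unfolding S(2)
        by (intro bexI[of _ g\<^sub>1]) (auto simp: g\<^sub>1_def lookup_minus lookup_mon)
    next
      case 2
      then show ?thesis
        using g_in_cone a12 a34 u unfolding S(2)
        by (intro bexI[of _ g\<^sub>2]) (auto simp: g\<^sub>2_def lookup_mon)
    next
      case 3
      then show ?thesis
        using g_in_cone a12 a34 u unfolding S(2)
        by (intro bexI[of _ g\<^sub>3]) (auto simp: g\<^sub>3_def lookup_minus lookup_mon)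
    qed
  qed (use S in auto)
  moreover have "card ?B = 3"
    using a12 a34 u by auto
  ultimately show ?thesis
    by simp
qed

lemma complete_intersection: "complete_intersection_tangent_cone K n"
proof -
  have "min_num_generators mpoly_ring cone \<le> enat (card {g\<^sub>1, g\<^sub>2, g\<^sub>3})"
    unfolding min_num_generators_def by (rule INF_lower) (auto simp: cone_eq_Idl)
  also have "card {g\<^sub>1, g\<^sub>2, g\<^sub>3} \<le> 3"
    using card_length[of "[g\<^sub>1, g\<^sub>2, g\<^sub>3]"] by simp
  finally have "min_num_generators mpoly_ring cone \<le> 3"
    by (simp add: numeral_eq_enat)
  moreover have "3 \<le> min_num_generators mpoly_ring cone"
    unfolding min_num_generators_def
    by (rule INF_greatest) (use three_generators in \<open>auto simp: numeral_eq_enat\<close>)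
  ultimately show ?thesis
    unfolding complete_intersection_tangent_cone_def by (rule antisym)
qed

end

theorem cohen_macaulay_iff_complete_intersection:
  "cohen_macaulay_tangent_cone K n \<longleftrightarrow> complete_intersection_tangent_cone K n"
  using not_cohen_macaulay not_complete_intersection cohen_macaulay complete_intersection
  by (cases "u\<^sub>1 + u\<^sub>2 < u\<^sub>4") auto

end

section \<open>Reduction to the normalized generators\<close>

lemma var_power: "(var i :: ('v, 'k::field) mpoly) ^ k = mon (Poly_Mapping.single i k)"
  by (induction k) (auto simp: var_def mult_single simp flip: single_add)

lemma var_power_expo:
  "(var 1 :: (4, 'k::field) mpoly) ^ k = mon (expo k 0 0 0)"
  "(var 2 :: (4, 'k::field) mpoly) ^ k = mon (expo 0 k 0 0)"
  "(var 3 :: (4, 'k::field) mpoly) ^ k = mon (expo 0 0 k 0)"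
  "(var 4 :: (4, 'k::field) mpoly) ^ k = mon (expo 0 0 0 k)"
  unfolding var_power expo_def by simp_all

lemma critical_exponent_le:
  assumes "0 < b" and "b * n i = (\<Sum>j \<in> UNIV - {i}. c j * n j)"
  shows "critical_exponent n i \<le> b"
  unfolding critical_exponent_def using assms by (intro Least_le) auto

lemma critical_exponent_pos:
  fixes n :: "'v::finite \<Rightarrow> nat"
  assumes "j \<noteq> i" "0 < n j"
  shows "0 < critical_exponent n i"
proof -
  have "(\<Sum>k \<in> UNIV - {i}. (if k = j then n i else 0) * n k) = (\<Sum>k \<in> UNIV - {i}. if k = j then n i * n k else 0)"
    by (rule sum.cong) auto
  then have "n j * n i = (\<Sum>k \<in> UNIV - {i}. (if k = j then n i else 0) * n k)"
    using assms(1) by simp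
  with assms(2) have "0 < n j \<and> (\<exists>c. n j * n i = (\<Sum>j \<in> UNIV - {i}. c j * n j))"
    by (intro conjI exI)
  then show ?thesis
    unfolding critical_exponent_def by (rule LeastI2) simp
qed

lemma sum_4:
  fixes c n :: "4 \<Rightarrow> nat"
  shows "(\<Sum>j \<in> UNIV - {1}. c j * n j) = c 2 * n 2 + c 3 * n 3 + c 4 * n 4"
    and "(\<Sum>j \<in> UNIV - {2}. c j * n j) = c 1 * n 1 + c 3 * n 3 + c 4 * n 4"
    and "(\<Sum>j \<in> UNIV - {3}. c j * n j) = c 1 * n 1 + c 2 * n 2 + c 4 * n 4"
    and "(\<Sum>j \<in> UNIV - {4}. c j * n j) = c 1 * n 1 + c 2 * n 2 + c 3 * n 3"
proof -
  have U: "UNIV - {1} = {2, 3, 4 :: 4}" "UNIV - {2} = {1, 3, 4 :: 4}"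
    "UNIV - {3} = {1, 2, 4 :: 4}" "UNIV - {4} = {1, 2, 3 :: 4}"
    unfolding UNIV_4 by auto
  show "(\<Sum>j \<in> UNIV - {1}. c j * n j) = c 2 * n 2 + c 3 * n 3 + c 4 * n 4"
    and "(\<Sum>j \<in> UNIV - {2}. c j * n j) = c 1 * n 1 + c 3 * n 3 + c 4 * n 4"
    and "(\<Sum>j \<in> UNIV - {3}. c j * n j) = c 1 * n 1 + c 2 * n 2 + c 4 * n 4"
    and "(\<Sum>j \<in> UNIV - {4}. c j * n j) = c 1 * n 1 + c 2 * n 2 + c 3 * n 3"
    unfolding U by simp_all
qed

lemma Idl_replace_generator:
  fixes f g h :: "'a::comm_ring_1"
  assumes "h' = h + p * f + q * g"
  shows "Idl\<^bsub>tring\<^esub> {f, g, h'} = Idl\<^bsub>tring\<^esub> {f, g, h}"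
proof
  have mem: "x \<in> S \<Longrightarrow> x \<in> Idl\<^bsub>tring\<^esub> S" for x :: 'a and S
    using Idl_tring(2) by blast
  note D = ideal_tringD[OF Idl_tring(1)]
  have "h' \<in> Idl\<^bsub>tring\<^esub> {f, g, h}"
    unfolding assms by (intro D(2,3) mem) auto
  then show "Idl\<^bsub>tring\<^esub> {f, g, h'} \<subseteq> Idl\<^bsub>tring\<^esub> {f, g, h}"
    by (intro Idl_tring(3) Idl_tring(1)) (auto intro: mem)
  have "h = h' - p * f - q * g"
    by (simp add: assms)
  also have "\<dots> \<in> Idl\<^bsub>tring\<^esub> {f, g, h'}"
    by (intro D(6,3) mem) auto
  finally show "Idl\<^bsub>tring\<^esub> {f, g, h} \<subseteq> Idl\<^bsub>tring\<^esub> {f, g, h'}"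
    by (intro Idl_tring(3) Idl_tring(1)) (auto intro: mem)
qed

theorem theorem2p3:
  fixes n a u :: "4 \<Rightarrow> nat"
  assumes pos: "\<And>i. 0 < n i"
    and gcd: "Gcd (range n) = 1"
    and a: "\<And>i. a i = critical_exponent n i"
    and gens: "minimally_generated_by mpoly_ring (toric_ideal n :: (4, 'k::field) mpoly set)
        [var 1 ^ a 1 - var 2 ^ a 2,
         var 3 ^ a 3 - var 4 ^ a 4,
         var 1 ^ u 1 * var 2 ^ u 2 - var 3 ^ u 3 * var 4 ^ u 4]"
    and min: "n 1 = Min (range n)"
    and a34: "a 3 < a 4"
    and u2: "u 2 \<le> a 2"
    and u3: "u 3 \<le> a 3"
    and u34: "u 3 = 0 \<or> u 4 = 0"
  shows "cohen_macaulay_tangent_cone TYPE('k) n \<longleftrightarrow>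
         complete_intersection_tangent_cone TYPE('k) n"
proof -
  have least: "n 1 \<le> n i" for i
    unfolding min by (rule Min_le) auto
  let ?f1 = "mon (expo (a 1) 0 0 0) - mon (expo 0 (a 2) 0 0) :: (4, 'k) mpoly"
  let ?f2 = "mon (expo 0 0 (a 3) 0) - mon (expo 0 0 0 (a 4)) :: (4, 'k) mpoly"
  let ?f3 = "mon (expo (u 1) (u 2) 0 0) - mon (expo 0 0 (u 3) (u 4)) :: (4, 'k) mpoly"
  let ?I = "toric_ideal n :: (4, 'k) mpoly set"
  have gens': "Idl\<^bsub>mpoly_ring\<^esub> {?f1, ?f2, ?f3} = ?I" "Idl\<^bsub>mpoly_ring\<^esub> {?f1, ?f2} \<noteq> ?I"
    using gens[unfolded minimally_generated_by_def, THEN conjunct2]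
    by (simp_all add: var_power_expo All_less_Suc2)
  have in_I: "?f1 \<in> ?I" "?f2 \<in> ?I" "?f3 \<in> ?I"
    unfolding gens'(1)[symmetric] by (rule subsetD[OF Idl_tring(2)], simp)+
  have w: "n 1 * a 1 = n 2 * a 2" "n 3 * a 3 = n 4 * a 4"
    "n 1 * u 1 + n 2 * u 2 = n 3 * u 3 + n 4 * u 4"
    using in_I unfolding toric_ideal_binomial_iff weighted_degree_expo by (simp_all del: One_nat_def)
  have a_pos: "0 < a 1" "0 < a 2" "0 < a 3" "0 < a 4"
    unfolding a by (rule critical_exponent_pos[of 2] critical_exponent_pos[of 1]; use pos in simp)+
  have a_le: "a i \<le> b" if "0 < b" "b * n i = (\<Sum>j \<in> UNIV - {i}. c j * n j)" for i b c
    unfolding a by (rule critical_exponent_le[OF that])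
  have a12: "a 2 \<le> a 1"
  proof (rule ccontr)
    assume "\<not> a 2 \<le> a 1"
    then have "n 1 * a 1 < n 1 * a 2"
      using pos[of 1] by simp
    also have "\<dots> \<le> n 2 * a 2"
      using least[of 2] by simp
    finally show False
      using w(1) by simp
  qed
  \<comment> \<open>Equal exponents give \<open>n 2 = n 1\<close>, so \<open>1 * n 2\<close> is
    already a combination of the other weights.\<close>
  have a12_eq: "a 2 = 1" if "a 1 = a 2"
  proof -
    have "n 2 = n 1"
      using w(1) that a_pos by simp
    then have "a 2 \<le> 1"
      by (intro a_le[where c = "\<lambda>j. if j = 1 then 1 else 0"]) (simp_all add: sum_4)
    then show ?thesis
      using a_pos(2) by simp
  qed
  \<comment> \<open>If the right-hand monomial were 1, the weights would make the third generator 0,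
    contrary to minimality.\<close>
  have u_nz: "u 3 + u 4 \<noteq> 0"
  proof
    assume "u 3 + u 4 = 0"
    then have "u 1 = 0" "u 2 = 0" "u 3 = 0" "u 4 = 0"
      using w(3) pos[of 1] pos[of 2] by auto
    then have "?f3 = 0"
      by simp
    then have "{?f1, ?f2, ?f3} \<subseteq> Idl\<^bsub>mpoly_ring\<^esub> {?f1, ?f2}"
      using Idl_tring(2)[of "{?f1, ?f2}"] ideal_tringD(1)[OF Idl_tring(1)[of "{?f1, ?f2}"]] by simp
    then have "?I \<subseteq> Idl\<^bsub>mpoly_ring\<^esub> {?f1, ?f2}"
      unfolding gens'(1)[symmetric] by (rule Idl_tring(3)[OF Idl_tring(1)])
    moreover have "Idl\<^bsub>mpoly_ring\<^esub> {?f1, ?f2} \<subseteq> ?I"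
      unfolding gens'(1)[symmetric]
      by (intro Idl_tring(3) Idl_tring(1) order_trans[OF _ Idl_tring(2)]) auto
    ultimately show False
      using gens'(2) by simp
  qed
  obtain u4 where u4: "0 < u4"
    "?I = Idl\<^bsub>mpoly_ring\<^esub> {?f1, ?f2, mon (expo (u 1) (u 2) 0 0) - mon (expo 0 0 0 u4)}"
  proof (cases "u 3 = 0")
    case True
    then show ?thesis
      using u_nz gens'(1) by (intro that[of "u 4"]) simp_all
  next
    case False
    then have "u 4 = 0"
      using u34 by simp
    \<comment> \<open>The third binomial presents \<open>u 3 * n 3\<close> as a combination of the
      other weights, so \<open>u 3 = a 3\<close>; adding the second generator then trades the third
      variable for the fourth.\<close>
    have "a 3 \<le> u 3"
      using False w(3) \<open>u 4 = 0\<close>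
      by (intro a_le[where c = "\<lambda>j. if j = 1 then u 1 else if j = 2 then u 2 else 0"])
         (simp_all add: sum_4 mult.commute)
    then have "u 3 = a 3"
      using u3 by simp
    then have "mon (expo (u 1) (u 2) 0 0) - mon (expo 0 0 0 (a 4)) = ?f3 + 0 * ?f1 + 1 * ?f2"
      using \<open>u 4 = 0\<close> by simp
    from Idl_replace_generator[OF this] show ?thesis
      using gens'(1) a_pos(4) by (intro that[of "a 4"]) simp_all
  qed
  obtain u1 u2' where u': "0 < u1" "u2' < a 2"
    "?I = Idl\<^bsub>mpoly_ring\<^esub> {?f1, ?f2, mon (expo u1 u2' 0 0) - mon (expo 0 0 0 u4)}"
  proof (cases "u 2 < a 2")
    case True
    have "mon (expo (u 1) (u 2) 0 0) - mon (expo 0 0 0 u4) \<in> ?I"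
      unfolding u4(2) by (rule subsetD[OF Idl_tring(2)]) simp
    then have w3: "n 1 * u 1 + n 2 * u 2 = n 4 * u4"
      unfolding toric_ideal_binomial_iff weighted_degree_expo by (simp del: One_nat_def)
    \<comment> \<open>With \<open>u 1 = 0\<close> the multiple \<open>u 2 * n 2\<close> would equal
      \<open>u4 * n 4\<close>, although \<open>u 2\<close> is below the critical exponent.\<close>
    have "u 1 \<noteq> 0"
    proof
      assume "u 1 = 0"
      moreover have "0 < n 4 * u4"
        using pos[of 4] u4(1) by simp
      ultimately have "0 < u 2" "u 2 * n 2 = u4 * n 4"
        using w3 by (auto simp: mult.commute intro: Nat.gr0I)
      then have "a 2 \<le> u 2"
        by (intro a_le[where c = "\<lambda>j. if j = 4 then u4 else 0"]) (simp_all add: sum_4)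
      then show False
        using True by simp
    qed
    then show ?thesis
      using True u4(2) by (intro that[of "u 1" "u 2"]) simp_all
  next
    case False
    then have "u 2 = a 2"
      using u2 by simp
    \<comment> \<open>For \<open>u 2 = a 2\<close>, a multiple of the first generator trades the
      power of the second variable for \<open>a 1\<close> further factors of the first, so the new
      exponents are \<open>u 1 + a 1\<close> and 0.\<close>
    then have "mon (expo (u 1 + a 1) 0 0 0) - mon (expo 0 0 0 u4) =
        (mon (expo (u 1) (u 2) 0 0) - mon (expo 0 0 0 u4)) + mon (expo (u 1) 0 0 0) * ?f1 + 0 * ?f2"
      by (simp add: right_diff_distrib)
    from Idl_replace_generator[OF this] show ?thesis
      using a_pos u4(2) by (intro that[of "u 1 + a 1" 0]) simp_all
  qed
  interpret reduced_curve n "TYPE('k)" "a 1" "a 2" "a 3" "a 4" u1 u2' u4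
    using pos least u'(3) a_pos a12 a12_eq a34 u'(1,2) u4(1) by unfold_locales
  show ?thesis
    by (rule cohen_macaulay_iff_complete_intersection)
qed

end
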